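(* Let $T$ be an algebraic torus over an algebraically closed field $k$, with character lattice $\Lambda$, acting on $\mathbb{P}(V)$, $V=k^n$, by $t(x_1:\ldots:x_n)=(\chi_1(t)x_1:\ldots:\chi_n(t)x_n)$ with $\chi_1,\ldots,\chi_n\in\Lambda$. Then the orbit closure $X=\overline{T(1:\ldots:1)}\subset\mathbb{P}(V)$ satisfies the separation property (SP) if and only if the following conditions hold: (1) the point $\chi_i$ is a vertex of the convex hull $\mathrm{conv}\{\chi_1,\ldots,\chi_n\}$ for every $i$; (2) $\chi_i\neq\chi_j$ for $i\neq j$.
   Context: A subset $Y\subset\mathbb{P}(V)$ has the separation property (SP) if for any pair $D\neq D'$ of hyperplanes in $\mathbb{P}(V)$ one has $D\cap Y\not\subseteq D'$. Closures are Zariski closures. The convex hull is taken in $\Lambda\otimes_{\mathbb{Z}}\mathbb{Q}$. *)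

theory Defs
  imports "HOL-Analysis.Analysis" "HOL-Library.Poly_Mapping"
    "HOL-Computational_Algebra.Polynomial"
begin

section \<open>Projective space and its Zariski topology\<close>

text \<open>The points of \<open>\<P>(V)\<close>, \<open>V = k\<^sup>n\<close>, are the lines through the origin of \<open>V\<close>.\<close>

definition proj_space :: "('k::field ^ 'n) set set" where
  "proj_space = {L. vec.subspace L \<and> vec.dim L = 1}"

text \<open>\<open>hom_coords x\<close> is the point \<open>(x\<^sub>1 : \<dots> : x\<^sub>n)\<close>; it is meaningful for \<open>x \<noteq> 0\<close> only.\<close>

definition hom_coords :: "'k::field ^ 'n \<Rightarrow> ('k ^ 'n) set" where
  "hom_coords x = vec.span {x}"

definition proj_hyperplane :: "('k::field ^ 'n) set set \<Rightarrow> bool" where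
  "proj_hyperplane D \<longleftrightarrow>
     (\<exists>H. vec.subspace H \<and> vec.dim H + 1 = CARD('n) \<and> D = {L \<in> proj_space. L \<subseteq> H})"

text \<open>
  A polynomial in the coordinates \<open>x\<^sub>i\<close> maps exponents, which are themselves
  finitely supported functions on the index set, to coefficients.
\<close>

type_synonym ('n, 'k) mpolynomial = "('n \<Rightarrow>\<^sub>0 nat) \<Rightarrow>\<^sub>0 'k"

definition mpoly_eval :: "('n::finite, 'k::field) mpolynomial \<Rightarrow> 'k ^ 'n \<Rightarrow> 'k" where
  "mpoly_eval f x =
     (\<Sum>e\<in>Poly_Mapping.keys f. Poly_Mapping.lookup f e * (\<Prod>i\<in>UNIV. x $ i ^ Poly_Mapping.lookup e i))"

definition homogeneous :: "('n::finite, 'k::field) mpolynomial \<Rightarrow> bool" where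
  "homogeneous f \<longleftrightarrow>
     (\<exists>d. \<forall>e\<in>Poly_Mapping.keys f. (\<Sum>i\<in>UNIV. Poly_Mapping.lookup e i) = d)"

definition proj_zeros :: "('n::finite, 'k::field) mpolynomial set \<Rightarrow> ('k ^ 'n) set set" where
  "proj_zeros F = {L \<in> proj_space. \<forall>f\<in>F. \<forall>x\<in>L. mpoly_eval f x = 0}"

definition zariski_closed :: "('k::field ^ 'n::finite) set set \<Rightarrow> bool" where
  "zariski_closed Z \<longleftrightarrow> (\<exists>F. (\<forall>f\<in>F. homogeneous f) \<and> Z = proj_zeros F)"

definition zariski_closure :: "('k::field ^ 'n::finite) set set \<Rightarrow> ('k ^ 'n) set set" where
  "zariski_closure Y = zariski_closed hull Y"

definition separation_property :: "('k::field ^ 'n) set set \<Rightarrow> bool" where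
  "separation_property Y \<longleftrightarrow>
     (\<forall>D D'. proj_hyperplane D \<and> proj_hyperplane D' \<and> D \<noteq> D' \<longrightarrow> \<not> D \<inter> Y \<subseteq> D')"


section \<open>Tori and characters\<close>

text \<open>
  The torus of rank \<open>r\<close> is \<open>(k\<^sup>*)\<^sup>r\<close>, and its character lattice is \<open>\<int>\<^sup>r\<close>, the exponent
  \<open>m\<close> standing for the character \<open>t \<mapsto> t\<^sub>0\<^bsup>m\<^sub>0\<^esup> \<cdots> t\<^bsub>r-1\<^esub>\<^bsup>m\<^bsub>r-1\<^esub>\<^esup>\<close>. Tuples of length \<open>r\<close> are
  functions on \<open>nat\<close> that take the neutral value from \<open>r\<close> on; rank \<open>0\<close> is allowed.
  The lemmas on \<open>algebraic_character\<close> below justify this description of the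
  character lattice: the Laurent monomials are exactly the homomorphisms of algebraic
  groups to \<open>k\<^sup>*\<close>, and distinct exponents give distinct characters.
\<close>

definition torus :: "nat \<Rightarrow> (nat \<Rightarrow> 'k::field) set" where
  "torus r = {t. (\<forall>j<r. t j \<noteq> 0) \<and> (\<forall>j\<ge>r. t j = 1)}"

definition character_lattice :: "nat \<Rightarrow> (nat \<Rightarrow> int) set" where
  "character_lattice r = {m. \<forall>j\<ge>r. m j = 0}"

definition torus_character :: "nat \<Rightarrow> (nat \<Rightarrow> int) \<Rightarrow> (nat \<Rightarrow> 'k::field) \<Rightarrow> 'k" where
  "torus_character r m t = (\<Prod>j<r. t j powi m j)"

definition regular_function :: "nat \<Rightarrow> ((nat \<Rightarrow> 'k::field) \<Rightarrow> 'k) \<Rightarrow> bool" where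
  "regular_function r f \<longleftrightarrow>
     (\<exists>M c. finite M \<and> M \<subseteq> character_lattice r \<and>
       (\<forall>t\<in>torus r. f t = (\<Sum>m\<in>M. c m * torus_character r m t)))"

definition algebraic_character :: "nat \<Rightarrow> ((nat \<Rightarrow> 'k::field) \<Rightarrow> 'k) \<Rightarrow> bool" where
  "algebraic_character r f \<longleftrightarrow>
     regular_function r f \<and> (\<forall>t\<in>torus r. f t \<noteq> 0) \<and>
     (\<forall>s\<in>torus r. \<forall>t\<in>torus r. f (\<lambda>j. s j * t j) = f s * f t)"

lemma one_in_torus: "(\<lambda>_. 1) \<in> torus r"
  by (simp add: torus_def)

lemma mult_in_torus: "s \<in> torus r \<Longrightarrow> t \<in> torus r \<Longrightarrow> (\<lambda>j. s j * t j) \<in> torus r"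
  by (simp add: torus_def)

lemma torus_character_one: "torus_character r m (\<lambda>_. 1) = 1"
  by (simp add: torus_character_def)

lemma torus_character_mult:
  "torus_character r m (\<lambda>j. s j * t j) = torus_character r m s * torus_character r m t"
  by (simp add: torus_character_def power_int_mult_distrib prod.distrib)

lemma torus_character_nonzero: "t \<in> torus r \<Longrightarrow> torus_character r m t \<noteq> 0"
  by (simp add: torus_character_def torus_def)

lemma torus_character_add:
  "t \<in> torus r \<Longrightarrow>
    torus_character r (\<lambda>j. m j + m' j) t = torus_character r m t * torus_character r m' t"
  by (simp add: torus_character_def torus_def power_int_add prod.distrib)

lemma power_int_distinct:
  assumes "(d::int) \<noteq> 0"
  shows "\<exists>a::'k::alg_closed_field. a \<noteq> 0 \<and> a powi d \<noteq> 1"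
proof (rule ccontr)
  assume neg: "\<not> ?thesis"
  define n where "n = nat \<bar>d\<bar>"
  have n: "n > 0" using assms by (simp add: n_def)
  have *: "a ^ n = 1" if "a \<noteq> 0" for a :: 'k
  proof -
    have "a powi d = 1" using neg that by blast
    moreover have "d = int n \<or> d = - int n" by (auto simp: n_def)
    ultimately show ?thesis by (auto simp: power_int_minus)
  qed
  define p :: "'k poly" where "p = monom 1 (Suc n) + [:1, -1:]"
  have "degree p = Suc n"
    unfolding p_def using n by (subst degree_add_eq_left) (auto simp: degree_monom_eq)
  then obtain a where "poly p a = 0"
    using alg_closed_imp_poly_has_root[of p] by auto
  then have "a * a ^ n + (1 - a) = 0"
    by (simp add: p_def poly_monom)
  then show False
    using *[of a] by (cases "a = 0") auto
qed

lemma torus_character_distinct: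
  assumes "m \<in> character_lattice r" "m' \<in> character_lattice r" "m \<noteq> m'"
  shows "\<exists>t\<in>torus r. torus_character r m t \<noteq> (torus_character r m' t :: 'k::alg_closed_field)"
proof -
  obtain j where j: "m j \<noteq> m' j" using assms(3) by blast
  have jr: "j < r"
    using assms(1,2) j by (metis (mono_tags, lifting) character_lattice_def mem_Collect_eq not_le)
  obtain a :: 'k where a: "a \<noteq> 0" "a powi (m j - m' j) \<noteq> 1"
    using power_int_distinct[of "m j - m' j"] j by auto
  define t where "t = (\<lambda>i. if i = j then a else 1)"
  have ev: "torus_character r l t = a powi l j" for l
  proof -
    have "torus_character r l t = (\<Prod>i<r. if i = j then a powi l j else 1)"
      unfolding torus_character_def by (rule prod.cong) (auto simp: t_def)
    then show ?thesis using jr by simp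
  qed
  have "t \<in> torus r" using a jr by (auto simp: torus_def t_def)
  moreover have "a powi m j \<noteq> a powi m' j"
    using a by (simp add: power_int_diff)
  ultimately show ?thesis using ev by metis
qed

lemma torus_characters_independent:
  fixes c :: "(nat \<Rightarrow> int) \<Rightarrow> 'k::alg_closed_field"
  assumes "finite M" "M \<subseteq> character_lattice r"
    and "\<And>t. t \<in> torus r \<Longrightarrow> (\<Sum>m\<in>M. c m * torus_character r m t) = 0"
  shows "\<forall>m\<in>M. c m = 0"
  using assms
proof (induction M arbitrary: c rule: finite_induct)
  case empty
  then show ?case by simp
next
  case (insert m0 M)
  have M: "c m = 0" if m: "m \<in> M" for m
  proof -
    obtain s :: "nat \<Rightarrow> 'k" where s: "s \<in> torus r" "torus_character r m s \<noteq> torus_character r m0 s"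
      using torus_character_distinct[of m r m0, where 'k = 'k] m insert.hyps(2) insert.prems(1)
      by auto
    define c' where "c' = (\<lambda>m. c m * (torus_character r m s - torus_character r m0 s))"
    have "(\<Sum>m\<in>M. c' m * torus_character r m t) = 0" if t: "t \<in> torus r" for t
    proof -
      have "(\<Sum>m\<in>insert m0 M. c' m * torus_character r m t)
          = (\<Sum>m\<in>insert m0 M. c m * torus_character r m (\<lambda>j. s j * t j)
              - torus_character r m0 s * (c m * torus_character r m t))"
        by (rule sum.cong) (simp_all add: c'_def torus_character_mult algebra_simps)
      also have "\<dots> = (\<Sum>m\<in>insert m0 M. c m * torus_character r m (\<lambda>j. s j * t j))
          - torus_character r m0 s * (\<Sum>m\<in>insert m0 M. c m * torus_character r m t)"
        by (simp only: sum_subtractf sum_distrib_left)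
      also have "\<dots> = 0"
        by (simp only: insert.prems(2)[OF t] insert.prems(2)[OF mult_in_torus[OF s(1) t]]
            mult_zero_right diff_self)
      finally have "(\<Sum>m\<in>insert m0 M. c' m * torus_character r m t) = 0" .
      then show ?thesis using insert.hyps by (simp add: c'_def)
    qed
    then have "\<forall>m\<in>M. c' m = 0" using insert.IH[of c'] insert.prems(1) by blast
    then show ?thesis using m s(2) by (auto simp: c'_def)
  qed
  have "c m0 = 0"
    using insert.prems(2)[OF one_in_torus] insert.hyps M by (simp add: torus_character_one)
  then show ?case using M by blast
qed

lemma algebraic_character_torus_character:
  assumes "m \<in> character_lattice r"
  shows "algebraic_character r (torus_character r m)"
proof -
  have "regular_function r (torus_character r m)"
    unfolding regular_function_def
    by (rule exI[of _ "{m}"], rule exI[of _ "\<lambda>_. 1"]) (use assms in simp)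
  then show ?thesis
    by (simp add: algebraic_character_def torus_character_nonzero torus_character_mult)
qed

lemma algebraic_character_imp_torus_character:
  fixes f :: "(nat \<Rightarrow> 'k::alg_closed_field) \<Rightarrow> 'k"
  assumes "algebraic_character r f"
  shows "\<exists>!m. m \<in> character_lattice r \<and> (\<forall>t\<in>torus r. f t = torus_character r m t)"
proof -
  obtain M c where M: "finite M" "M \<subseteq> character_lattice r"
    and f: "\<And>t. t \<in> torus r \<Longrightarrow> f t = (\<Sum>m\<in>M. c m * torus_character r m t)"
    using assms by (auto simp: algebraic_character_def regular_function_def)
  have zero: "c m * (torus_character r m s - f s) = 0" if m: "m \<in> M" and s: "s \<in> torus r" for m s
  proof -
    have "(\<Sum>m\<in>M. (c m * (torus_character r m s - f s)) * torus_character r m t) = 0"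
      if t: "t \<in> torus r" for t
    proof -
      have "(\<Sum>m\<in>M. (c m * (torus_character r m s - f s)) * torus_character r m t)
          = (\<Sum>m\<in>M. c m * torus_character r m (\<lambda>j. s j * t j)
              - f s * (c m * torus_character r m t))"
        by (rule sum.cong) (simp_all add: torus_character_mult algebra_simps)
      also have "\<dots> = f (\<lambda>j. s j * t j) - f s * f t"
        by (simp only: sum_subtractf sum_distrib_left f[OF t] f[OF mult_in_torus[OF s t]])
      also have "\<dots> = 0"
        using assms s t by (simp add: algebraic_character_def)
      finally show ?thesis .
    qed
    then show ?thesis
      using torus_characters_independent[OF M, of "\<lambda>m. c m * (torus_character r m s - f s)"] m
      by simp
  qed
  have "f (\<lambda>_. 1) \<noteq> 0"
    using assms one_in_torus by (auto simp: algebraic_character_def)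
  then obtain m where m: "m \<in> M" "c m \<noteq> 0"
    using f[OF one_in_torus] by (metis (no_types, lifting) mult_zero_left sum.neutral)
  then have "m \<in> character_lattice r \<and> (\<forall>t\<in>torus r. f t = torus_character r m t)"
    using zero M by fastforce
  moreover have "m' = m"
    if "m' \<in> character_lattice r \<and> (\<forall>t\<in>torus r. f t = torus_character r m' t)" for m'
    using torus_character_distinct[of m' r m, where 'k = 'k] that calculation by force
  ultimately show ?thesis by blast
qed


section \<open>The torus action\<close>

text \<open>Projective points are lines, and \<open>t\<close> acts on them as the diagonal matrix with entries \<open>\<chi>\<^sub>i(t)\<close>.\<close>

definition torus_act ::
    "nat \<Rightarrow> ('n \<Rightarrow> nat \<Rightarrow> int) \<Rightarrow> (nat \<Rightarrow> 'k::field) \<Rightarrow> ('k ^ 'n) set \<Rightarrow> ('k ^ 'n) set" where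
  "torus_act r w t L = (\<lambda>x. \<chi> i. torus_character r (w i) t * x $ i) ` L"

definition orbit_closure :: "nat \<Rightarrow> ('n::finite \<Rightarrow> nat \<Rightarrow> int) \<Rightarrow> ('k::field ^ 'n) set set" where
  "orbit_closure r w =
     zariski_closure ((\<lambda>t. torus_act r w t (hom_coords (\<chi> i. 1))) ` torus r)"


section \<open>Convexity over the rationals\<close>

text \<open>
  The library's convex hulls and extreme points are confined to real vector spaces;
  the following are the same notions for \<open>\<rat>\<^sup>r \<subseteq> (nat \<Rightarrow> rat)\<close>. As in the
  library, a vertex is a point not interior to any segment of the set.
\<close>

definition rat_convex :: "(nat \<Rightarrow> rat) set \<Rightarrow> bool" where
  "rat_convex S \<longleftrightarrow>
     (\<forall>x\<in>S. \<forall>y\<in>S. \<forall>u\<ge>0. \<forall>v\<ge>0. u + v = 1 \<longrightarrow> (\<lambda>j. u * x j + v * y j) \<in> S)"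

definition rat_open_segment :: "(nat \<Rightarrow> rat) \<Rightarrow> (nat \<Rightarrow> rat) \<Rightarrow> (nat \<Rightarrow> rat) set" where
  "rat_open_segment a b =
     {x. a \<noteq> b \<and> (\<exists>u. 0 < u \<and> u < 1 \<and> x = (\<lambda>j. (1 - u) * a j + u * b j))}"

definition vertex_of :: "(nat \<Rightarrow> rat) \<Rightarrow> (nat \<Rightarrow> rat) set \<Rightarrow> bool" where
  "vertex_of x S \<longleftrightarrow> x \<in> S \<and> (\<forall>a\<in>S. \<forall>b\<in>S. x \<notin> rat_open_segment a b)"

definition rat_point :: "(nat \<Rightarrow> int) \<Rightarrow> nat \<Rightarrow> rat" where
  "rat_point m = (\<lambda>j. rat_of_int (m j))"

end

theory Submission
  imports Defs
begin

text \<open>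
  Both conditions together say that no \<open>\<chi>\<^sub>i\<close> is a convex combination of the other characters,
  counted with multiplicity. A relation \<open>d \<chi>\<^sub>i = \<Sum>\<^sub>k n\<^sub>k \<chi>\<^sub>k\<close> with \<open>n\<^sub>i = 0\<close> and
  \<open>d = \<Sum>\<^sub>k n\<^sub>k > 0\<close> gives \<open>x\<^sub>i\<^sup>d = \<Prod>\<^sub>k x\<^sub>k\<close> (to the powers \<open>n\<^sub>k\<close>) on \<open>X\<close>, so \<open>X \<inter> {x\<^sub>m = 0}\<close>
  lies in \<open>{x\<^sub>i = 0}\<close> whenever \<open>n\<^sub>m > 0\<close>, and (SP) fails.

  Conversely, suppose there is no such relation and \<open>X \<inter> {a = 0} \<subseteq> {b = 0}\<close> for linear forms
  \<open>a, b\<close>. The coordinate points lie in \<open>X\<close>, so \<open>b\<^sub>i = 0\<close> wherever \<open>a\<^sub>i = 0\<close>. If \<open>\<chi>\<^sub>i, \<chi>\<^sub>j\<close> span an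
  edge of the convex hull of the support of \<open>a\<close>, restrict \<open>a\<close> and \<open>b\<close> to a two-dimensional torus
  and degenerate to that edge: roots of \<open>a\<close> remain roots of \<open>b\<close>, and on the edge \<open>a\<close> is the
  binomial \<open>a\<^sub>i x\<^sub>i + a\<^sub>j x\<^sub>j\<close>, whence \<open>b\<^sub>i / a\<^sub>i = b\<^sub>j / a\<^sub>j\<close>. The edge graph is connected, by the
  simplex method, so \<open>b\<close> is proportional to \<open>a\<close>.
\<close>

section \<open>Linear inequalities over the rationals\<close>

definition pairing :: "nat \<Rightarrow> (nat \<Rightarrow> rat) \<Rightarrow> (nat \<Rightarrow> rat) \<Rightarrow> rat" where
  "pairing r l x = (\<Sum>j<r. l j * x j)"

lemma pairing_add_left: "pairing r (\<lambda>j. l j + m j) x = pairing r l x + pairing r m x"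
  by (simp add: pairing_def sum.distrib algebra_simps)

lemma pairing_scale_left: "pairing r (\<lambda>j. c * l j) x = c * pairing r l x"
  by (simp add: pairing_def sum_distrib_left algebra_simps)

lemma pairing_add_right: "pairing r l (\<lambda>j. x j + y j) = pairing r l x + pairing r l y"
  by (simp add: pairing_def sum.distrib algebra_simps)

lemma pairing_diff_right: "pairing r l (\<lambda>j. x j - y j) = pairing r l x - pairing r l y"
  by (simp add: pairing_def sum_subtractf algebra_simps)

lemma pairing_scale_right: "pairing r l (\<lambda>j. c * x j) = c * pairing r l x"
  by (simp add: pairing_def sum_distrib_left algebra_simps)

lemmas pairing_simps = pairing_add_left pairing_scale_left pairing_add_right
  pairing_diff_right pairing_scale_right

text \<open>Positive combinations of at least one vector. Zero is not put in by hand, so its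
  membership expresses a nontrivial relation.\<close>

inductive_set open_cone :: "(nat \<Rightarrow> rat) set \<Rightarrow> (nat \<Rightarrow> rat) set" for U where
  base: "u \<in> U \<Longrightarrow> u \<in> open_cone U"
| scale: "x \<in> open_cone U \<Longrightarrow> 0 < c \<Longrightarrow> (\<lambda>j. c * x j) \<in> open_cone U"
| add: "x \<in> open_cone U \<Longrightarrow> y \<in> open_cone U \<Longrightarrow> (\<lambda>j. x j + y j) \<in> open_cone U"

lemma open_cone_trans:
  assumes "x \<in> open_cone U'" "U' \<subseteq> open_cone U"
  shows "x \<in> open_cone U"
  using assms by (induction rule: open_cone.induct) (auto intro: open_cone.intros)

text \<open>In the elimination below, \<open>A\<close> and \<open>B\<close> hold the lower and the
  upper bounds on the new coefficient of the functional; density of the rationals leaves room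
  between them.\<close>

lemma finite_separation:
  fixes A B :: "rat set"
  assumes "finite A" "finite B" "\<And>a b. a \<in> A \<Longrightarrow> b \<in> B \<Longrightarrow> a < b"
  shows "\<exists>x. (\<forall>a\<in>A. a < x) \<and> (\<forall>b\<in>B. x < b)"
proof (cases "A = {}")
  case True
  show ?thesis
  proof (cases "B = {}")
    case False
    have "Min B - 1 < b" if "b \<in> B" for b using Min_le[OF assms(2) that] by linarith
    then show ?thesis using True by blast
  qed (use True in auto)
next
  case A: False
  show ?thesis
  proof (cases "B = {}")
    case True
    have "\<forall>a\<in>A. a < Max A + 1" using assms(1) by (auto simp: le_less_trans[OF Max_ge])
    then show ?thesis using True by blast
  next
    case False
    then have "Max A < Min B" using assms A by simp
    then obtain x where "Max A < x" "x < Min B" using dense by blast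
    then show ?thesis using assms A False by auto
  qed
qed

text \<open>Gordan's alternative, by Fourier-Motzkin elimination of the last coordinate.\<close>

lemma gordan_alternative:
  assumes "finite U"
  shows "(\<exists>l. \<forall>u\<in>U. 0 < pairing r l u) \<or> (\<exists>x\<in>open_cone U. \<forall>j<r. x j = 0)"
  using assms
proof (induction r arbitrary: U)
  case 0
  then show ?case by (cases "U = {}") (auto intro: open_cone.base)
next
  case (Suc r)
  define P where "P = {u\<in>U. u r > 0}"
  define N where "N = {u\<in>U. u r < 0}"
  define Z where "Z = {u\<in>U. u r = 0}"
  \<comment> \<open>For \<open>u\<close> in \<open>P\<close> and \<open>v\<close> in
    \<open>N\<close> both factors \<open>- v r\<close> and \<open>u r\<close> are positive, and the
    combination cancels coordinate \<open>r\<close>.\<close>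
  define comb where "comb = (\<lambda>(u, v) j. (- v r) * u j + u r * v (j :: nat) :: rat)"
  define U' where "U' = Z \<union> comb ` (P \<times> N)"
  have fin: "finite P" "finite N" "finite Z" "finite U'"
    using Suc.prems by (auto simp: P_def N_def Z_def U'_def)
  have sub: "U' \<subseteq> open_cone U"
  proof -
    have "(\<lambda>j. (- v r) * u j + u r * v j) \<in> open_cone U" if "u \<in> P" "v \<in> N" for u v
      using that by (intro open_cone.add open_cone.scale open_cone.base) (auto simp: P_def N_def)
    then show ?thesis by (auto simp: U'_def comb_def Z_def intro: open_cone.base)
  qed
  have last0: "x r = 0" if "x \<in> open_cone U'" for x
    using that by (induction rule: open_cone.induct) (auto simp: U'_def Z_def comb_def)
  from Suc.IH[OF fin(4)] show ?case
  proof
    assume "\<exists>x\<in>open_cone U'. \<forall>j<r. x j = 0"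
    then obtain x where "x \<in> open_cone U'" "\<forall>j<r. x j = 0" by blast
    then show ?thesis using last0[of x] open_cone_trans[OF _ sub, of x]
      by (auto simp: less_Suc_eq intro!: bexI[of _ x])
  next
    assume "\<exists>l. \<forall>u\<in>U'. 0 < pairing r l u"
    then obtain l where l: "\<And>u. u \<in> U' \<Longrightarrow> 0 < pairing r l u" by blast
    \<comment> \<open>With last coefficient \<open>x\<close> the functional takes the value
      \<open>pairing r l u + x * u r\<close> on \<open>u\<close>. Positivity is a lower bound on
      \<open>x\<close> for \<open>u\<close> in \<open>P\<close> and an upper bound for
      \<open>u\<close> in \<open>N\<close>; the bounds are compatible because \<open>l\<close> is
      positive on every \<open>comb (u, v)\<close>.\<close>
    have "\<exists>x. (\<forall>a\<in>(\<lambda>u. - pairing r l u / u r) ` P. a < x) \<and>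
              (\<forall>b\<in>(\<lambda>v. - pairing r l v / v r) ` N. x < b)"
    proof (rule finite_separation)
      fix a b assume "a \<in> (\<lambda>u. - pairing r l u / u r) ` P" "b \<in> (\<lambda>v. - pairing r l v / v r) ` N"
      then obtain u v where u: "u \<in> P" "a = - pairing r l u / u r"
        and v: "v \<in> N" "b = - pairing r l v / v r" by blast
      have "0 < pairing r l (comb (u, v))" using u v by (intro l) (auto simp: U'_def)
      moreover have "pairing r l (comb (u, v)) = (- v r) * pairing r l u + u r * pairing r l v"
        unfolding comb_def split_conv by (simp only: pairing_add_right pairing_scale_right)
      moreover have "u r > 0" "v r < 0" using u v by (auto simp: P_def N_def)
      ultimately show "a < b" unfolding u(2) v(2) by (simp add: field_simps)
    qed (use fin in auto)
    then obtain x where x: "\<And>u. u \<in> P \<Longrightarrow> - pairing r l u / u r < x"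
      "\<And>v. v \<in> N \<Longrightarrow> x < - pairing r l v / v r" by blast
    have val: "pairing (Suc r) (l(r := x)) u = pairing r l u + x * u r" for u
      by (simp add: pairing_def)
    have "0 < pairing (Suc r) (l(r := x)) u" if "u \<in> U" for u
    proof -
      have "u \<in> P \<or> u \<in> N \<or> u \<in> Z" using that by (auto simp: P_def N_def Z_def)
      then consider "u \<in> P" | "u \<in> N" | "u \<in> Z" by blast
      then show ?thesis
      proof cases
        case 1
        then have "u r > 0" by (simp add: P_def)
        then show ?thesis using x(1)[OF 1] val by (simp add: field_simps)
      next
        case 2
        then have "u r < 0" by (simp add: N_def)
        then show ?thesis using x(2)[OF 2] val by (simp add: field_simps)
      next
        case 3
        then show ?thesis using l[of u] val by (auto simp: U'_def Z_def)
      qed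
    qed
    then show ?thesis by blast
  qed
qed

text \<open>The coefficients are attached to indices, not to vectors, so \<open>u\<close> may repeat
  values. The positive sum permits a later normalisation to total weight 1.\<close>

lemma open_cone_image_coefficients:
  assumes "x \<in> open_cone (u ` K)" "finite K"
  shows "\<exists>c. (\<forall>k. 0 \<le> c k) \<and> 0 < sum c K \<and> x = (\<lambda>j. \<Sum>k\<in>K. c k * u k j)"
  using assms(1)
proof (induction rule: open_cone.induct)
  case (base y)
  then obtain k where k: "k \<in> K" "y = u k" by blast
  have "y = (\<lambda>j. \<Sum>l\<in>K. (if l = k then 1 else 0) * u l j)"
    using k assms(2) by (auto simp: if_distrib[of "\<lambda>z. z * _"] cong: if_cong)
  then show ?case using k assms(2) by (intro exI[of _ "\<lambda>l. if l = k then 1 else 0"]) simp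
next
  case (scale x a)
  then obtain c where "(\<forall>k. 0 \<le> c k) \<and> 0 < sum c K \<and> x = (\<lambda>j. \<Sum>k\<in>K. c k * u k j)" by blast
  then show ?case using scale.hyps
    by (intro exI[of _ "\<lambda>k. a * c k"]) (auto simp: sum_distrib_left mult.assoc simp flip: sum_distrib_left)
next
  case (add x y)
  then obtain c d where "(\<forall>k. 0 \<le> c k) \<and> 0 < sum c K \<and> x = (\<lambda>j. \<Sum>k\<in>K. c k * u k j)"
    "(\<forall>k. 0 \<le> d k) \<and> 0 < sum d K \<and> y = (\<lambda>j. \<Sum>k\<in>K. d k * u k j)" by blast
  then show ?case
    by (intro exI[of _ "\<lambda>k. c k + d k"]) (auto simp: sum.distrib algebra_simps)
qed

section \<open>Generic functionals and edges\<close>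

lemma perturb_positive:
  fixes f g :: "'a \<Rightarrow> rat"
  assumes "finite U" "\<And>u. u \<in> U \<Longrightarrow> 0 < f u"
  shows "\<exists>e>0. \<forall>u\<in>U. 0 < f u + e * g u"
proof -
  \<comment> \<open>All smaller \<open>d\<close> are included, so that the induction step can take
    the minimum of two bounds.\<close>
  have "\<exists>e>0. \<forall>d. 0 < d \<and> d \<le> e \<longrightarrow> (\<forall>u\<in>U. 0 < f u + d * g u)"
    using assms
  proof (induction U rule: finite_induct)
    case empty
    then show ?case by (auto intro: exI[of _ 1])
  next
    case (insert v U)
    then obtain e where e: "e > 0" "\<forall>d. 0 < d \<and> d \<le> e \<longrightarrow> (\<forall>u\<in>U. 0 < f u + d * g u)" by auto
    \<comment> \<open>The summand 1 avoids division by zero and yields strictness: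
      \<open>d * (\<bar>g v\<bar> + 1) \<le> f v\<close> gives
      \<open>f v + d * g v \<ge> d\<close>.\<close>
    define e' where "e' = f v / (\<bar>g v\<bar> + 1)"
    have fv: "f v > 0" using insert.prems by simp
    have "0 < f v + d * g v" if "0 < d" "d \<le> e'" for d
    proof -
      have "d * (\<bar>g v\<bar> + 1) \<le> f v" using that unfolding e'_def by (simp add: pos_le_divide_eq)
      moreover have "d * - g v \<le> d * \<bar>g v\<bar>" using that by (intro mult_left_mono) auto
      ultimately show ?thesis using that by (simp add: algebra_simps)
    qed
    moreover have "e' > 0" using fv by (simp add: e'_def)
    ultimately show ?case using e by (intro exI[of _ "min e e'"]) auto
  qed
  then show ?thesis by blast
qed

text \<open>Strict inequalities on a finite set survive a small perturbation, so the vectors of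
  \<open>V\<close> can be treated one at a time.\<close>

lemma perturb_functional:
  assumes "finite V" "finite U" "\<And>u. u \<in> U \<Longrightarrow> 0 < pairing r l u"
    and "\<And>v. v \<in> V \<Longrightarrow> \<exists>h. pairing r h v \<noteq> 0"
  shows "\<exists>l'. (\<forall>u\<in>U. 0 < pairing r l' u) \<and> (\<forall>v\<in>V. pairing r l' v \<noteq> 0)"
  using assms
proof (induction V arbitrary: U l rule: finite_induct)
  case empty
  then show ?case by blast
next
  case (insert v V)
  obtain h where h: "pairing r h v \<noteq> 0" using insert.prems(3) by blast
  obtain l' where l': "\<forall>u\<in>U. 0 < pairing r l' u" "pairing r l' v \<noteq> 0"
  proof (cases "pairing r l v = 0")
    case False
    then show ?thesis using that insert.prems by blast
  next
    case True
    obtain e where "e > 0" "\<forall>u\<in>U. 0 < pairing r l u + e * pairing r h u"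
      using perturb_positive[OF insert.prems(1), of "pairing r l" "pairing r h"] insert.prems(2) by blast
    then show ?thesis using that[of "\<lambda>j. l j + e * h j"] h True by (auto simp: pairing_simps)
  qed
  \<comment> \<open>Once \<open>l'\<close> is nonzero on \<open>v\<close>, its sign there becomes
    one more strict inequality, which the perturbations for the remaining vectors preserve.\<close>
  define c :: rat where "c = (if pairing r l' v > 0 then 1 else -1)"
  have "0 < pairing r l' u" if "u \<in> insert (\<lambda>j. c * v j) U" for u
    using l' that by (auto simp: pairing_simps c_def)
  then have "\<exists>l''. (\<forall>u\<in>insert (\<lambda>j. c * v j) U. 0 < pairing r l'' u) \<and> (\<forall>v\<in>V. pairing r l'' v \<noteq> 0)"
    using insert.prems by (intro insert.IH[where l = l']) auto
  then obtain l'' where l'': "0 < c * pairing r l'' v" "\<forall>u\<in>U. 0 < pairing r l'' u"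
    "\<forall>v\<in>V. pairing r l'' v \<noteq> 0" by (auto simp: pairing_scale_right)
  then have "pairing r l'' v \<noteq> 0" by auto
  with l'' show ?case by blast
qed

text \<open>The pivot step of the simplex method: follow \<open>l + s c\<close> for growing \<open>s\<close> until \<open>i\<close> stops being
  the only maximiser; for generic \<open>l\<close> exactly one other vertex ties with it.\<close>

lemma improving_edge:
  fixes p :: "'a \<Rightarrow> nat \<Rightarrow> rat"
  assumes "finite I" "i \<in> I" "m \<in> I" "pairing r c (p i) < pairing r c (p m)"
    and strict: "\<And>i. i \<in> I \<Longrightarrow> \<exists>l. \<forall>k\<in>I - {i}. pairing r l (p k) < pairing r l (p i)"
  shows "\<exists>j\<in>I. pairing r c (p i) < pairing r c (p j) \<and>
    (\<exists>f. pairing r f (p j) = pairing r f (p i) \<and> (\<forall>k\<in>I - {i, j}. pairing r f (p k) < pairing r f (p i)))"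
proof -
  define K where "K = {k\<in>I. pairing r c (p i) < pairing r c (p k)}"
  \<comment> \<open>\<open>x k\<close> is the speed at which \<open>k\<close> gains on
    \<open>i\<close> along \<open>l + s c\<close>; only the indices in \<open>K\<close> can catch
    up.\<close>
  define x where "x = (\<lambda>k. pairing r c (p k) - pairing r c (p i))"
  have x: "x k > 0" if "k \<in> K" for k using that by (simp add: x_def K_def)
  have K: "finite K" "K \<noteq> {}" "K \<subseteq> I - {i}" using assms by (auto simp: K_def)
  define U where "U = (\<lambda>k j. p i j - p k j) ` (I - {i})"
  \<comment> \<open>For \<open>k\<close> and \<open>k'\<close> in \<open>K\<close>, a functional
    \<open>l\<close> vanishes on \<open>v (k, k')\<close> exactly when both catch up with
    \<open>i\<close> at the same \<open>s\<close>.\<close>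
  define v where "v = (\<lambda>(k, k') j. x k' * (p i j - p k j) - x k * (p i j - p k' j))"
  define V where "V = v ` {(k, k') \<in> K \<times> K. k \<noteq> k'}"
  have v: "pairing r h (v (k, k')) = x k' * (pairing r h (p i) - pairing r h (p k))
      - x k * (pairing r h (p i) - pairing r h (p k'))" for h k k'
    unfolding v_def by (simp add: pairing_simps)
  have nz: "\<exists>h. pairing r h (v (k, k')) \<noteq> 0" if k: "k \<in> K" "k' \<in> K" "k \<noteq> k'" "x k \<le> x k'" for k k'
  proof -
    obtain h where "\<forall>q\<in>I - {k}. pairing r h (p q) < pairing r h (p k)"
      using strict[of k] k(1) K(3) by blast
    then have h: "pairing r h (p i) < pairing r h (p k)" "pairing r h (p k') < pairing r h (p k)"
      using k K(3) assms(2) by auto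
    \<comment> \<open>The value of \<open>h\<close> on \<open>v (k, k')\<close> is the sum of this
      negative term and a nonpositive one. Both signs come out right because \<open>h\<close>
      exposes the slower of the two indices.\<close>
    have "x k * (pairing r h (p k') - pairing r h (p k)) < 0"
      using x[OF k(1)] h(2) by (simp add: mult_pos_neg)
    moreover have "(x k' - x k) * (pairing r h (p i) - pairing r h (p k)) \<le> 0"
      using k(4) h(1) by (simp add: mult_nonneg_nonpos)
    ultimately have "pairing r h (v (k, k')) < 0"
      unfolding v by (simp add: algebra_simps)
    then show ?thesis by (intro exI[of _ h]) simp
  qed
  have nz': "\<exists>h. pairing r h u \<noteq> 0" if u: "u \<in> V" for u
  proof -
    obtain k k' where k: "u = v (k, k')" "k \<in> K" "k' \<in> K" "k \<noteq> k'" using u by (auto simp: V_def)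
    show ?thesis
    proof (cases "x k \<le> x k'")
      case True
      then show ?thesis using nz k by blast
    next
      case False
      then obtain h where "pairing r h (v (k', k)) \<noteq> 0" using nz[of k' k] k by auto
      then show ?thesis unfolding k(1) v by (intro exI[of _ h]) auto
    qed
  qed
  obtain l0 where l0: "\<forall>k\<in>I - {i}. pairing r l0 (p k) < pairing r l0 (p i)"
    using strict[OF assms(2)] by blast
  have "\<exists>l. (\<forall>u\<in>U. 0 < pairing r l u) \<and> (\<forall>u\<in>V. pairing r l u \<noteq> 0)"
  proof (rule perturb_functional[OF _ _ _ nz'])
    have "finite {(k, k') \<in> K \<times> K. k \<noteq> k'}"
      by (rule finite_subset[of _ "K \<times> K"]) (use K in auto)
    then show "finite V" by (simp add: V_def)
    show "finite U" using assms by (simp add: U_def)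
    show "0 < pairing r l0 u" if "u \<in> U" for u
      using that l0 by (auto simp: U_def pairing_simps)
  qed
  then obtain l where l: "\<And>k. k \<in> I - {i} \<Longrightarrow> 0 < pairing r l (p i) - pairing r l (p k)"
    and lv: "\<And>k k'. k \<in> K \<Longrightarrow> k' \<in> K \<Longrightarrow> k \<noteq> k' \<Longrightarrow> pairing r l (v (k, k')) \<noteq> 0"
    by (auto simp: U_def V_def pairing_simps)
  define y where "y = (\<lambda>k. pairing r l (p i) - pairing r l (p k))"
  \<comment> \<open>The ratio test: \<open>k\<close> ties with \<open>i\<close> at the parameter
    \<open>q k\<close>, and genericity of \<open>l\<close> makes the minimum over \<open>K\<close>
    unique.\<close>
  define q where "q = (\<lambda>k. y k / x k)"
  obtain j where j: "j \<in> K" "\<And>k. k \<in> K \<Longrightarrow> q j \<le> q k"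
    using ex_min_if_finite[of "q ` K"] K by (auto simp: not_less)
  have qj: "q j < q k" if "k \<in> K" "k \<noteq> j" for k
  proof -
    have "q j \<noteq> q k" using lv[OF that(1) j(1) that(2)] x[OF j(1)] x[OF that(1)]
      unfolding v q_def y_def by (auto simp: field_simps)
    then show ?thesis using j(2)[OF that(1)] by simp
  qed
  define f where "f = (\<lambda>a. l a + q j * c a)"
  have f: "pairing r f (p i) - pairing r f (p k) = y k - q j * x k" for k
    unfolding f_def y_def x_def by (simp add: pairing_simps) (simp add: algebra_simps)
  have "pairing r f (p k) < pairing r f (p i)" if k: "k \<in> I - {i, j}" for k
  proof -
    have "y k - q j * x k > 0"
    proof (cases "k \<in> K")
      case True
      then show ?thesis using qj[of k] k x[OF True] by (simp add: q_def pos_less_divide_eq)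
    next
      case False
      have "q j > 0" using l[of j] j(1) K(3) x[OF j(1)] unfolding q_def y_def by (intro divide_pos_pos) auto
      moreover have "x k \<le> 0" using False k by (auto simp: K_def x_def)
      ultimately have "q j * x k \<le> 0" by (simp add: mult_nonneg_nonpos)
      moreover have "y k > 0" using l[of k] k by (auto simp: y_def)
      ultimately show ?thesis by linarith
    qed
    then show ?thesis using f[of k] by linarith
  qed
  moreover have "pairing r f (p j) = pairing r f (p i)"
    using f[of j] x[OF j(1)] by (simp add: q_def)
  moreover have "j \<in> I" "pairing r c (p i) < pairing r c (p j)" using j(1) by (auto simp: K_def)
  ultimately show ?thesis by blast
qed

lemma clear_denominators:
  fixes q :: "'a \<Rightarrow> rat"
  assumes "finite A"
  shows "\<exists>D>0. \<forall>a\<in>A. \<exists>z. of_int z = of_int D * q a"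
  using assms
proof (induction A rule: finite_induct)
  case empty
  then show ?case by (intro exI[of _ 1]) simp
next
  case (insert a A)
  then obtain D where D: "D > 0" "\<forall>a\<in>A. \<exists>z. of_int z = of_int D * q a" by blast
  obtain m n where mn: "quotient_of (q a) = (m, n)" by fastforce
  have q: "q a = of_int m / of_int n" "n > 0"
    using quotient_of_div[OF mn] quotient_of_denom_pos[OF mn] by simp_all
  have "\<exists>z. of_int z = of_int (D * n) * q b" if "b \<in> insert a A" for b
  proof (cases "b = a")
    case True
    then show ?thesis using q by (intro exI[of _ "D * m"]) simp
  next
    case False
    then have "b \<in> A" using that by simp
    with D(2) obtain z where z: "of_int z = of_int D * q b" by (elim ballE exE) auto
    then show ?thesis by (intro exI[of _ "z * n"]) (simp add: z)
  qed
  then have "0 < D * n \<and> (\<forall>b\<in>insert a A. \<exists>z. of_int z = of_int (D * n) * q b)"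
    using D(1) q(2) by (intro conjI ballI) auto
  then show ?case by (rule exI)
qed

section \<open>Convex dependence and vertices\<close>

lemma sum_drop:
  fixes g :: "'a::finite \<Rightarrow> 'b::ab_group_add"
  shows "(\<Sum>k\<in>UNIV. if k = i then 0 else g k) = sum g UNIV - g i"
proof -
  have "(\<Sum>k\<in>UNIV. if k = i then 0 else g k) = sum g (UNIV - {i})"
    by (subst sum.remove[of UNIV i]) (auto intro: sum.cong)
  also have "\<dots> = sum g UNIV - g i" by (simp add: sum.remove[of UNIV i])
  finally show ?thesis .
qed

lemma rat_convex_sum:
  fixes p :: "'a \<Rightarrow> nat \<Rightarrow> rat"
  assumes "finite A" "rat_convex S" "p ` A \<subseteq> S" "\<And>k. k \<in> A \<Longrightarrow> 0 \<le> c k" "sum c A = 1"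
  shows "(\<lambda>j. \<Sum>k\<in>A. c k * p k j) \<in> S"
  using assms
proof (induction A arbitrary: c rule: finite_induct)
  case empty
  then show ?case by simp
next
  case (insert a A)
  define s where "s = sum c A"
  have s: "0 \<le> s" "c a + s = 1" using insert by (auto simp: s_def intro!: sum_nonneg)
  show ?case
  proof (cases "s = 0")
    case True
    then have "\<forall>k\<in>A. c k = 0" using insert by (subst (asm) s_def, subst (asm) sum_nonneg_eq_0_iff) auto
    then show ?thesis using insert s True by simp
  next
    case False
    have "(\<lambda>j. \<Sum>k\<in>A. c k / s * p k j) \<in> S"
      using insert.prems False s by (intro insert.IH) (auto simp: s_def simp flip: sum_divide_distrib)
    then have "(\<lambda>j. c a * p a j + s * (\<Sum>k\<in>A. c k / s * p k j)) \<in> S"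
      using insert.prems s unfolding rat_convex_def by auto
    also have "(\<lambda>j. c a * p a j + s * (\<Sum>k\<in>A. c k / s * p k j)) = (\<lambda>j. \<Sum>k\<in>insert a A. c k * p k j)"
      using insert.hyps False by (simp add: sum_distrib_left)
    finally show ?thesis .
  qed
qed

lemma rat_convex_hull_range:
  fixes p :: "'a::finite \<Rightarrow> nat \<Rightarrow> rat"
  shows "rat_convex hull range p =
    {(\<lambda>j. \<Sum>k\<in>UNIV. c k * p k j) | c. (\<forall>k. 0 \<le> c k) \<and> sum c UNIV = 1}" (is "_ = ?C")
proof
  have "p k \<in> ?C" for k
  proof -
    have "p k = (\<lambda>j. \<Sum>l\<in>UNIV. (if l = k then 1 else 0) * p l j)"
      by (auto simp: if_distrib[of "\<lambda>z. z * _"] cong: if_cong)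
    moreover have "(\<Sum>l\<in>UNIV. if l = k then 1 else (0::rat)) = 1" by simp
    ultimately show ?thesis by (intro CollectI exI[of _ "\<lambda>l. if l = k then 1 else 0"]) auto
  qed
  moreover have "rat_convex ?C"
    unfolding rat_convex_def
  proof (intro ballI allI impI)
    fix x y u v assume "x \<in> ?C" "y \<in> ?C" and uv: "0 \<le> u" "0 \<le> v" "u + v = (1::rat)"
    then obtain c d where c: "\<forall>k. 0 \<le> c k" "sum c UNIV = 1" "x = (\<lambda>j. \<Sum>k\<in>UNIV. c k * p k j)"
      and d: "\<forall>k. 0 \<le> d k" "sum d UNIV = 1" "y = (\<lambda>j. \<Sum>k\<in>UNIV. d k * p k j)" by blast
    have "(\<lambda>j. u * x j + v * y j) = (\<lambda>j. \<Sum>k\<in>UNIV. (u * c k + v * d k) * p k j)"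
      by (simp add: c d sum_distrib_left sum.distrib algebra_simps)
    moreover have "(\<Sum>k\<in>UNIV. u * c k + v * d k) = 1"
      using c d uv by (simp add: sum.distrib flip: sum_distrib_left)
    ultimately show "(\<lambda>j. u * x j + v * y j) \<in> ?C"
      using c d uv by (intro CollectI exI[of _ "\<lambda>k. u * c k + v * d k"]) auto
  qed
  ultimately show "rat_convex hull range p \<subseteq> ?C" by (intro hull_minimal) auto
  show "?C \<subseteq> rat_convex hull range p"
  proof
    fix x assume "x \<in> ?C"
    then obtain c where c: "\<forall>k. 0 \<le> c k" "sum c UNIV = 1" "x = (\<lambda>j. \<Sum>k\<in>UNIV. c k * p k j)" by blast
    show "x \<in> rat_convex hull range p"
      unfolding hull_def c(3) by (intro InterI rat_convex_sum) (use c in auto)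
  qed
qed

text \<open>The condition \<open>c i = 0\<close> removes the index \<open>i\<close>, not the point
  \<open>p i\<close>: a point that occurs twice is already a dependence, with weight 1 on its other
  index.\<close>

definition convex_dependent :: "('a::finite \<Rightarrow> nat \<Rightarrow> rat) \<Rightarrow> bool" where
  "convex_dependent p \<longleftrightarrow> (\<exists>i c. (\<forall>k. 0 \<le> c k) \<and> c i = 0 \<and> sum c UNIV = 1 \<and>
     p i = (\<lambda>j. \<Sum>k\<in>UNIV. c k * p k j))"

text \<open>The share \<open>d i\<close> of \<open>p i\<close> itself is less than 1, so it moves to
  the left-hand side and the remaining weights are divided by \<open>1 - d i\<close>.\<close>

lemma convex_dependentI:
  assumes "\<And>k. 0 \<le> d k" "sum d UNIV = 1" "d i \<noteq> 1" "p i = (\<lambda>j. \<Sum>k\<in>UNIV. d k * p k j)"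
  shows "convex_dependent p"
proof -
  define c where "c = (\<lambda>k. if k = i then 0 else d k / (1 - d i))"
  have "d i \<le> sum d UNIV" using assms(1) by (intro member_le_sum) auto
  then have di: "1 - d i > 0" using assms(2,3) by linarith
  have "sum c UNIV = 1"
    using di unfolding c_def sum_drop by (simp add: assms(2) flip: sum_divide_distrib diff_divide_distrib)
  moreover have "p i j = (\<Sum>k\<in>UNIV. c k * p k j)" for j
  proof -
    have "(\<Sum>k\<in>UNIV. c k * p k j) = (\<Sum>k\<in>UNIV. if k = i then 0 else d k / (1 - d i) * p k j)"
      by (rule sum.cong) (auto simp: c_def)
    also have "\<dots> = ((\<Sum>k\<in>UNIV. d k * p k j) - d i * p i j) / (1 - d i)"
      unfolding sum_drop by (simp add: sum_divide_distrib diff_divide_distrib)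
    also have "(\<Sum>k\<in>UNIV. d k * p k j) = p i j" using assms(4) by (rule fun_cong[symmetric])
    also have "(p i j - d i * p i j) / (1 - d i) = p i j" using di by (simp add: field_simps)
    finally show ?thesis by simp
  qed
  moreover have "0 \<le> c k" for k using assms(1) di by (simp add: c_def)
  moreover have "c i = 0" by (simp add: c_def)
  ultimately show ?thesis unfolding convex_dependent_def by blast
qed

text \<open>Given a dependence, splitting off an index \<open>k\<close> of positive weight puts
  \<open>p i\<close> inside the segment from \<open>p k\<close> to the weighted mean
  \<open>y\<close> of the others; the degenerate cases would force \<open>p i = p k\<close>, against
  injectivity. Conversely, an open segment of the hull through \<open>p i\<close> yields a convex
  combination in which \<open>p i\<close> has weight less than 1, for otherwise both endpoints would
  be \<open>p i\<close>.\<close>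

lemma vertices_distinct_iff:
  fixes p :: "'a::finite \<Rightarrow> nat \<Rightarrow> rat"
  shows "(\<forall>i. vertex_of (p i) (rat_convex hull range p)) \<and> inj p \<longleftrightarrow> \<not> convex_dependent p"
proof (intro iffI notI conjI allI)
  assume *: "(\<forall>i. vertex_of (p i) (rat_convex hull range p)) \<and> inj p" and "convex_dependent p"
  then obtain i c where c: "\<And>k. 0 \<le> c k" "c i = 0" "sum c UNIV = 1"
    "p i = (\<lambda>j. \<Sum>k\<in>UNIV. c k * p k j)" unfolding convex_dependent_def by blast
  obtain k where k: "c k \<noteq> 0" using c(3) by (metis sum.neutral zero_neq_one)
  then have ki: "p k \<noteq> p i" using * c(2) by (metis injD)
  have "c k \<le> sum c UNIV" using c(1) by (intro member_le_sum) auto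
  define y where "y = (\<lambda>j. \<Sum>l\<in>UNIV. (if l = k then 0 else c l / (1 - c k)) * p l j)"
  have rest: "p i j = c k * p k j + (\<Sum>l\<in>UNIV. if l = k then 0 else c l * p l j)" for j
    unfolding sum_drop by (subst c(4)) simp
  show False
  proof (cases "c k = 1")
    case True
    then have "(\<Sum>l\<in>UNIV. if l = k then 0 else c l) = 0" unfolding sum_drop using c(3) by simp
    then have "\<forall>l\<in>UNIV. (if l = k then 0 else c l) = 0"
      by (subst (asm) sum_nonneg_eq_0_iff) (use c(1) in auto)
    then have "c l = 0" if "l \<noteq> k" for l using that by (auto split: if_splits)
    then have "p i j = p k j" for j unfolding rest True by (auto intro!: sum.neutral)
    then show False using ki by auto
  next
    case False
    then have u: "0 < 1 - c k" "1 - c k < 1" using \<open>c k \<le> _\<close> c(1)[of k] c(3) k by auto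
    have "y \<in> rat_convex hull range p"
      unfolding rat_convex_hull_range y_def
    proof (intro CollectI exI[of _ "\<lambda>l. if l = k then 0 else c l / (1 - c k)"] conjI allI refl)
      show "0 \<le> (if l = k then 0 else c l / (1 - c k))" for l using c(1) u by simp
      show "(\<Sum>l\<in>UNIV. if l = k then 0 else c l / (1 - c k)) = 1"
        unfolding sum_drop using u c(3) by (simp flip: sum_divide_distrib diff_divide_distrib)
    qed
    have py: "p i j = (1 - (1 - c k)) * p k j + (1 - c k) * y j" for j
      unfolding rest y_def using u by (auto simp: sum_distrib_left intro!: sum.cong)
    have "y \<noteq> p k"
    proof
      assume "y = p k"
      then have "p i j = p k j" for j using py[of j] by (simp add: algebra_simps)
      then show False using ki by auto
    qed
    then have "p i \<in> rat_open_segment (p k) y"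
      unfolding rat_open_segment_def using u py by blast
    moreover have "p k \<in> rat_convex hull range p" by (simp add: hull_inc)
    ultimately show False using * \<open>y \<in> _\<close> unfolding vertex_of_def by blast
  qed
next
  assume nd: "\<not> convex_dependent p"
  show "inj p"
  proof (rule injI, rule ccontr)
    fix i k assume ik: "p i = p k" "i \<noteq> k"
    have "convex_dependent p"
    proof (rule convex_dependentI)
      show "p i = (\<lambda>j. \<Sum>l\<in>UNIV. (if l = k then 1 else 0) * p l j)"
        using ik(1) by (auto simp: if_distrib[of "\<lambda>z. z * _"] cong: if_cong)
    qed (use ik in auto)
    then show False using nd by blast
  qed
  fix i
  show "vertex_of (p i) (rat_convex hull range p)"
    unfolding vertex_of_def
  proof (intro conjI ballI notI)
    show "p i \<in> rat_convex hull range p" by (simp add: hull_inc)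
    fix x y assume "x \<in> rat_convex hull range p" "y \<in> rat_convex hull range p"
      "p i \<in> rat_open_segment x y"
    then obtain c d u where c: "\<forall>k. 0 \<le> c k" "sum c UNIV = 1" "x = (\<lambda>j. \<Sum>k\<in>UNIV. c k * p k j)"
      and d: "\<forall>k. 0 \<le> d k" "sum d UNIV = 1" "y = (\<lambda>j. \<Sum>k\<in>UNIV. d k * p k j)"
      and u: "x \<noteq> y" "0 < u" "u < 1" "p i = (\<lambda>j. (1 - u) * x j + u * y j)"
      unfolding rat_convex_hull_range rat_open_segment_def by blast
    have "c i \<le> sum c UNIV" "d i \<le> sum d UNIV" using c d by (intro member_le_sum; auto)+
    then have le: "c i \<le> 1" "d i \<le> 1" using c d by auto
    have one: "z = p i" if "\<forall>k. 0 \<le> e k" "sum e UNIV = 1" "z = (\<lambda>j. \<Sum>k\<in>UNIV. e k * p k j)" "e i = 1"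
      for e :: "'a \<Rightarrow> rat" and z
    proof -
      have "(\<Sum>l\<in>UNIV. if l = i then 0 else e l) = 0" unfolding sum_drop using that by simp
      then have "\<forall>l\<in>UNIV. (if l = i then 0 else e l) = 0"
        by (subst (asm) sum_nonneg_eq_0_iff) (use that in auto)
      then have "e = (\<lambda>l. if l = i then 1 else 0)" using that(4) by (auto simp: fun_eq_iff split: if_splits)
      then show ?thesis using that(3) by (auto simp: if_distrib[of "\<lambda>z. z * _"] cong: if_cong)
    qed
    have "convex_dependent p"
    proof (rule convex_dependentI)
      show "p i = (\<lambda>j. \<Sum>k\<in>UNIV. ((1 - u) * c k + u * d k) * p k j)"
        unfolding u(4) by (simp add: c d sum_distrib_left sum.distrib algebra_simps sum_subtractf)
      show "(\<Sum>k\<in>UNIV. (1 - u) * c k + u * d k) = 1"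
        using c d by (simp add: sum.distrib flip: sum_distrib_left)
      show "0 \<le> (1 - u) * c k + u * d k" for k using c d u by simp
      show "(1 - u) * c i + u * d i \<noteq> 1"
      proof
        assume "(1 - u) * c i + u * d i = 1"
        then have "(1 - u) * (1 - c i) + u * (1 - d i) = 0" by (simp add: algebra_simps)
        then have "(1 - u) * (1 - c i) = 0 \<and> u * (1 - d i) = 0"
          using le u by (subst (asm) add_nonneg_eq_0_iff) auto
        then have "c i = 1" "d i = 1" using u by auto
        then show False using one[OF c] one[OF d] u(1) by simp
      qed
    qed
    then show False using nd by blast
  qed
qed

text \<open>Gordan's alternative for the differences \<open>p i - p k\<close>: a functional positive
  on them exposes \<open>p i\<close>, while a positive relation among them becomes a convex
  dependence after division by its total weight. Coordinates from \<open>r\<close> on vanish, so a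
  relation in the first \<open>r\<close> coordinates is a relation.\<close>

lemma exposed_of_not_convex_dependent:
  fixes p :: "'a::finite \<Rightarrow> nat \<Rightarrow> rat"
  assumes "\<not> convex_dependent p" "\<And>k j. j \<ge> r \<Longrightarrow> p k j = 0"
  shows "\<exists>l. \<forall>k. k \<noteq> i \<longrightarrow> pairing r l (p k) < pairing r l (p i)"
proof -
  define u where "u = (\<lambda>k j. p i j - p k j)"
  consider l where "\<forall>v\<in>u ` (UNIV - {i}). 0 < pairing r l v"
    | x where "x \<in> open_cone (u ` (UNIV - {i}))" "\<forall>j<r. x j = 0"
    using gordan_alternative[of "u ` (UNIV - {i})" r] by auto
  then show ?thesis
  proof cases
    case 1
    then show ?thesis by (intro exI[of _ l]) (auto simp: u_def pairing_simps)
  next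
    case 2
    then obtain c where c: "\<forall>k. 0 \<le> c k" "0 < sum c (UNIV - {i})"
      "x = (\<lambda>j. \<Sum>k\<in>UNIV - {i}. c k * u k j)"
      using open_cone_image_coefficients[of x u "UNIV - {i}"] by auto
    define s where "s = sum c (UNIV - {i})"
    define d where "d = (\<lambda>k. if k = i then 0 else c k / s)"
    have s: "s > 0" using c by (simp add: s_def)
    have "convex_dependent p"
    proof (rule convex_dependentI)
      show "0 \<le> d k" for k using c s by (simp add: d_def)
      show "d i \<noteq> 1" by (simp add: d_def)
      show "sum d UNIV = 1"
        using s by (subst sum.remove[of UNIV i]) (auto simp: d_def s_def simp flip: sum_divide_distrib)
      show "p i = (\<lambda>j. \<Sum>k\<in>UNIV. d k * p k j)"
      proof
        fix j
        have "(\<Sum>k\<in>UNIV - {i}. c k * u k j) = 0"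
          using 2(2) assms(2) unfolding c(3) by (cases "j < r") (auto simp: u_def)
        then have "s * p i j = (\<Sum>k\<in>UNIV - {i}. c k * p k j)"
          by (simp add: u_def s_def algebra_simps sum_subtractf sum_distrib_left)
        moreover have "(\<Sum>k\<in>UNIV. d k * p k j) = (\<Sum>k\<in>UNIV - {i}. c k * p k j) / s"
          by (subst sum.remove[of UNIV i]) (auto simp: d_def sum_divide_distrib)
        ultimately show "p i j = (\<Sum>k\<in>UNIV. d k * p k j)" using s
          by (metis less_irrefl nonzero_mult_div_cancel_left)
      qed
    qed
    then show ?thesis using assms(1) by blast
  qed
qed

section \<open>Degeneration of roots\<close>

text \<open>Otherwise \<open>pCons 1 p\<close>, that is 1 + X p, would be nonconstant and yet take
  the value 1 everywhere.\<close>

lemma poly_zero_if_zero_off_origin: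
  fixes p :: "'k::alg_closed_field poly"
  assumes "\<And>x. x \<noteq> 0 \<Longrightarrow> poly p x = 0"
  shows "p = 0"
proof (rule ccontr)
  assume "p \<noteq> 0"
  then have "degree (pCons 1 p) > 0" by simp
  then obtain x where "poly (pCons 1 p) x = 0" using alg_closed_imp_poly_has_root by blast
  then show False using assms[of x] by (cases "x = 0") auto
qed

text \<open>A univariate Nullstellensatz: each of the \<open>degree p\<close> linear factors of
  \<open>p\<close> divides \<open>q\<close>, so the power absorbs all multiplicities.\<close>

lemma dvd_power_degree_if_roots:
  fixes p q :: "'k::alg_closed_field poly"
  assumes "p \<noteq> 0" "\<And>x. poly p x = 0 \<Longrightarrow> poly q x = 0"
  shows "p dvd q ^ degree p"
proof -
  obtain A where A: "size A = degree p" "p = smult (lead_coeff p) (\<Prod>x\<in>#A. [:-x, 1:])"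
    using alg_closed_imp_factorization[OF assms(1)] by blast
  have "[:-x, 1:] dvd q" if "x \<in># A" for x
  proof -
    have "poly (smult (lead_coeff p) (\<Prod>x\<in>#A. [:-x, 1:])) x = 0"
      using that by (auto simp: poly_prod_mset prod_mset_zero_iff)
    then show ?thesis using assms(2) A(2) by (metis poly_eq_0_iff_dvd)
  qed
  then have "(\<Prod>x\<in>#A. [:-x, 1:]) dvd q ^ size A"
    by (induction A) (auto intro!: mult_dvd_mono simp del: mult_pCons_left)
  then show ?thesis
    using assms(1) A by (metis leading_coeff_0_iff smult_dvd)
qed

section \<open>Specialisation of polynomials in two variables\<close>

abbreviation eval_coeffs :: "'a::comm_ring_1 \<Rightarrow> 'a poly poly \<Rightarrow> 'a poly" where
  "eval_coeffs y \<equiv> map_poly (\<lambda>p. poly p y)"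

lemma eval_coeffs_add: "eval_coeffs y (p + q) = eval_coeffs y p + eval_coeffs y q"
  by (rule poly_eqI) (simp add: coeff_map_poly)

lemma eval_coeffs_mult: "eval_coeffs y (p * q) = eval_coeffs y p * eval_coeffs y q"
  by (rule poly_eqI) (simp add: coeff_map_poly coeff_mult poly_sum)

lemma eval_coeffs_smult: "eval_coeffs y (smult c q) = smult (poly c y) (eval_coeffs y q)"
  by (rule poly_eqI) (simp add: coeff_map_poly)

lemma eval_coeffs_power: "eval_coeffs y (p ^ n) = eval_coeffs y p ^ n"
  by (induction n) (simp_all add: eval_coeffs_mult)

lemma eval_coeffs_sum: "eval_coeffs y (sum f A) = (\<Sum>a\<in>A. eval_coeffs y (f a))"
  by (induction A rule: infinite_finite_induct) (simp_all add: eval_coeffs_add)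

lemma eval_coeffs_monom: "eval_coeffs y (monom c n) = monom (poly c y) n"
  by (rule poly_eqI) (simp add: coeff_map_poly)

text \<open>Since the leading coefficient is a unit, division with remainder is compatible with every
  specialisation, so a divisibility that holds for all \<open>y \<noteq> 0\<close> persists at \<open>y = 0\<close>.\<close>

lemma roots_persist_at_zero:
  fixes p q :: "'k::alg_closed_field poly poly"
  assumes "lead_coeff p = [:c:]" "c \<noteq> 0"
    and sub: "\<And>x y. y \<noteq> 0 \<Longrightarrow> poly (eval_coeffs y p) x = 0 \<Longrightarrow> poly (eval_coeffs y q) x = 0"
    and root: "poly (eval_coeffs 0 p) x = 0"
  shows "poly (eval_coeffs 0 q) x = 0"
proof -
  define d where "d = degree p"
  have p0: "p \<noteq> 0" using assms(1,2) by auto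
  \<comment> \<open>The leading coefficient does not depend on \<open>y\<close>, so no
    specialisation lowers the degree.\<close>
  have co: "coeff (eval_coeffs y p) d = c" for y
    using coeff_map_poly[of "\<lambda>p. poly p y" p "degree p"] assms(1) by (simp add: d_def)
  have nz: "eval_coeffs y p \<noteq> 0" for y
    using co[of y] assms(2) by auto
  have deg: "degree (eval_coeffs y p) = d" for y
    using co[of y] assms(2)
    by (intro antisym le_degree degree_le) (auto simp: d_def coeff_map_poly coeff_eq_0)
  \<comment> \<open>Pseudo-division multiplies \<open>q ^ d\<close> only by a power of the nonzero
    constant \<open>[:c:]\<close>; the exponent \<open>d\<close> is what
    \<open>dvd_power_degree_if_roots\<close> provides.\<close>
  obtain g s where gs: "pseudo_divmod (q ^ d) p = (g, s)" by fastforce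
  obtain n where "smult ([:c:] ^ n) (q ^ d) = p * g + s"
    using pseudo_divmod(1)[OF p0 gs] assms(1) by metis
  then have div: "smult (c ^ n) (eval_coeffs y q ^ d) = eval_coeffs y p * eval_coeffs y g + eval_coeffs y s" for y
  proof -
    have "eval_coeffs y (smult ([:c:] ^ n) (q ^ d)) = eval_coeffs y (p * g + s)"
      using \<open>smult ([:c:] ^ n) (q ^ d) = p * g + s\<close> by simp
    then show ?thesis
      by (simp add: eval_coeffs_add eval_coeffs_mult eval_coeffs_power eval_coeffs_smult)
  qed
  \<comment> \<open>The specialised \<open>p\<close> divides the specialised power of
    \<open>q\<close>, hence also the remainder, whose degree is too small unless it is zero.\<close>
  have "eval_coeffs y s = 0" if y: "y \<noteq> 0" for y
  proof (rule ccontr)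
    assume ne: "eval_coeffs y s \<noteq> 0"
    have "eval_coeffs y p dvd eval_coeffs y q ^ d"
      using dvd_power_degree_if_roots[OF nz sub[OF y]] deg by simp
    then have "eval_coeffs y p dvd smult (c ^ n) (eval_coeffs y q ^ d)" by (rule dvd_smult)
    then have "eval_coeffs y p dvd eval_coeffs y s"
      unfolding div by (simp add: dvd_add_right_iff)
    then have "d \<le> degree (eval_coeffs y s)" using dvd_imp_degree_le[OF _ ne] deg by metis
    moreover have "degree (eval_coeffs y s) \<le> degree s" 
      by (intro degree_le) (simp add: coeff_map_poly coeff_eq_0)
    moreover have "s \<noteq> 0" using ne by auto
    ultimately show False using pseudo_divmod(2)[OF p0 gs] by (simp add: d_def)
  qed
  then have "poly (coeff s i) y = 0" if "y \<noteq> 0" for i y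
    using that coeff_map_poly[of "\<lambda>p. poly p y" s i] by simp
  then have "s = 0" by (metis leading_coeff_0_iff poly_zero_if_zero_off_origin)
  then have "smult (c ^ n) (eval_coeffs 0 q ^ d) = eval_coeffs 0 p * eval_coeffs 0 g"
    using div[of 0] by simp
  then have "c ^ n * poly (eval_coeffs 0 q) x ^ d = 0"
    using root by (metis mult_zero_left poly_mult poly_power poly_smult)
  then show ?thesis using assms(2) by simp
qed

text \<open>As a polynomial in \<open>x\<close>, the sum for \<open>a\<close> has a constant leading
  coefficient: \<open>e\<close> singles out the term \<open>i\<close>, and \<open>f i = 0\<close>
  keeps \<open>y\<close> out of it. Hence roots persist at \<open>y = 0\<close>, where only the
  terms \<open>i\<close> and \<open>j\<close> survive; evaluating the sum for \<open>b\<close> at a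
  nonzero root of the binomial for \<open>a\<close> gives the proportion.\<close>

lemma ratio_eq_of_degeneration:
  fixes a b :: "'a::finite \<Rightarrow> 'k::alg_closed_field" and e f :: "'a \<Rightarrow> nat"
  assumes "i \<noteq> j" "a i \<noteq> 0" "a j \<noteq> 0"
    and supp: "\<And>k. a k = 0 \<Longrightarrow> b k = 0"
    and e: "\<And>k. a k \<noteq> 0 \<Longrightarrow> k \<noteq> i \<Longrightarrow> e k < e i"
    and f: "f i = 0" "f j = 0" "\<And>k. a k \<noteq> 0 \<Longrightarrow> k \<noteq> i \<Longrightarrow> k \<noteq> j \<Longrightarrow> f k > 0"
    and sub: "\<And>x y. x \<noteq> 0 \<Longrightarrow> y \<noteq> 0 \<Longrightarrow> (\<Sum>k\<in>UNIV. a k * (x ^ e k * y ^ f k)) = 0 \<Longrightarrow>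
      (\<Sum>k\<in>UNIV. b k * (x ^ e k * y ^ f k)) = 0"
  shows "b i * a j = b j * a i"
proof -
  define F where "F = (\<lambda>c :: 'a \<Rightarrow> 'k. \<Sum>k\<in>UNIV. monom (monom (c k) (f k)) (e k))"
  have ev: "poly (eval_coeffs y (F c)) x = (\<Sum>k\<in>UNIV. c k * (x ^ e k * y ^ f k))" for c x y
    by (simp add: F_def eval_coeffs_sum eval_coeffs_monom poly_sum poly_monom algebra_simps)
  have at0: "poly (eval_coeffs 0 (F c)) x = c i * x ^ e i + c j * x ^ e j"
    if "\<And>k. a k = 0 \<Longrightarrow> c k = 0" for c x
  proof -
    have "(\<Sum>k\<in>UNIV. c k * (x ^ e k * 0 ^ f k)) = (\<Sum>k\<in>{i, j}. c k * (x ^ e k * 0 ^ f k))"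
      by (rule sum.mono_neutral_right) (use f(3) that in \<open>auto, (metis not_gr0)+\<close>)
    then show ?thesis using assms(1) f by (simp add: ev)
  qed
  have co: "coeff (F a) n = (\<Sum>k\<in>UNIV. if e k = n then monom (a k) (f k) else 0)" for n
    by (simp add: F_def coeff_sum)
  have "(if e k = e i then monom (a k) (f k) else 0) = (if k = i then [:a i:] else 0)" for k
    using e[of k] f(1) by (cases "k = i"; cases "a k = 0") (auto simp: monom_0)
  then have coi: "coeff (F a) (e i) = [:a i:]" unfolding co by simp
  have "(if e k = n then monom (a k) (f k) else 0) = 0" if "n > e i" for k n
    using e[of k] that by (cases "k = i"; cases "a k = 0") auto
  then have "coeff (F a) n = 0" if "n > e i" for n
    using that unfolding co by simp
  then have "degree (F a) = e i"
    using coi assms(2) by (intro antisym degree_le le_degree) auto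
  then have lead: "lead_coeff (F a) = [:a i:]" using coi by simp
  have eji: "e j < e i" using e assms(1,3) by metis
  then obtain x where x: "x ^ (e i - e j) = - a j / a i"
    using nth_root_exists[of "e i - e j"] by auto
  have x0: "x \<noteq> 0" using x assms(2,3) eji by (auto simp: zero_power)
  have xe: "x ^ e i = (- a j / a i) * x ^ e j"
    using x eji by (metis le_add_diff_inverse2 less_imp_le power_add)
  \<comment> \<open>Since \<open>sub\<close> speaks of nonzero \<open>x\<close> only,
    \<open>F b\<close> is multiplied by the variable, which takes care of a root 0; the factor
    cancels at the nonzero \<open>x\<close> chosen here.\<close>
  have "poly (eval_coeffs 0 ([:0, 1:] * F b)) x = 0"
  proof (rule roots_persist_at_zero[OF lead assms(2)])
    show "poly (eval_coeffs 0 (F a)) x = 0" using at0[of a x] assms(2) by (simp add: xe)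
    fix u y :: 'k
    assume "y \<noteq> 0" "poly (eval_coeffs y (F a)) u = 0"
    then show "poly (eval_coeffs y ([:0, 1:] * F b)) u = 0"
      using sub[of u y] by (cases "u = 0") (simp_all add: ev eval_coeffs_mult map_poly_pCons del: mult_pCons_left)
  qed
  then have "b i * x ^ e i + b j * x ^ e j = 0"
    using at0[of b x] supp x0 by (simp add: eval_coeffs_mult map_poly_pCons del: mult_pCons_left)
  then have "x ^ e j * (b i * (- a j / a i) + b j) = 0" unfolding xe by (simp add: algebra_simps)
  then show ?thesis using x0 assms(2) by (simp add: field_simps)
qed

section \<open>Hyperplanes and torus orbits\<close>

definition linear_zeros :: "'k::field ^ 'n \<Rightarrow> ('k ^ 'n) set" where
  "linear_zeros a = {x. (\<Sum>i\<in>UNIV. a $ i * x $ i) = 0}"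

definition hyperplane_points :: "'k::field ^ 'n \<Rightarrow> ('k ^ 'n) set set" where
  "hyperplane_points a = {L \<in> proj_space. L \<subseteq> linear_zeros a}"

lemma subspace_linear_zeros: "vec.subspace (linear_zeros a)"
  by (rule vec.subspaceI)
    (auto simp: linear_zeros_def algebra_simps sum.distrib simp flip: sum_distrib_left)

text \<open>A vector \<open>v\<close> on which the linear form is 1 completes a basis of the kernel
  to a basis of the whole space.\<close>

lemma dim_linear_zeros:
  fixes a :: "'k::field ^ 'n"
  assumes "a \<noteq> 0"
  shows "vec.dim (linear_zeros a) + 1 = CARD('n)"
proof -
  obtain m where m: "a $ m \<noteq> 0" using assms by (auto simp: vec_eq_iff)
  define v :: "'k ^ 'n" where "v = axis m (1 / a $ m)"
  have v: "(\<Sum>i\<in>UNIV. a $ i * v $ i) = 1"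
    using m by (simp add: v_def axis_def if_distrib[of "\<lambda>z. _ * z"] cong: if_cong)
  obtain B where B: "B \<subseteq> linear_zeros a" "vec.independent B" "linear_zeros a \<subseteq> vec.span B"
    "card B = vec.dim (linear_zeros a)"
    using vec.basis_exists by blast
  have spB: "vec.span B = linear_zeros a"
    using B vec.span_minimal[OF B(1) subspace_linear_zeros] by blast
  have vB: "v \<notin> vec.span B" unfolding spB linear_zeros_def using v by simp
  have "x \<in> vec.span (insert v B)" for x
    unfolding vec.span_breakdown_eq spB
  proof (rule exI)
    define s where "s = (\<Sum>i\<in>UNIV. a $ i * x $ i)"
    show "x - s *s v \<in> linear_zeros a"
      using v by (simp add: linear_zeros_def right_diff_distrib sum_subtractf mult.left_commute[of _ s]
          s_def[symmetric] flip: sum_distrib_left)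
  qed
  then have "vec.span (insert v B) = vec.span UNIV" by auto
  then have "vec.dim (UNIV :: ('k ^ 'n) set) = card (insert v B)"
    using vec.independent_insertI[OF vB B(2)] by (rule vec.dim_eq_card)
  moreover have "v \<notin> B" using vB vec.span_base by blast
  moreover have "finite B" using B(2) by (rule vec.finiteI_independent)
  ultimately show ?thesis using B(4) vec_dim_card[where 'a='k and 'n='n] by simp
qed

text \<open>A basis of \<open>H\<close> needs one more vector \<open>v\<close> to become a basis of
  the space; the coordinate along \<open>v\<close> is a linear form with kernel \<open>H\<close>,
  and \<open>a\<close> lists its values on the standard basis.\<close>

lemma subspace_eq_linear_zeros:
  fixes H :: "('k::field ^ 'n) set"
  assumes H: "vec.subspace H" "vec.dim H + 1 = CARD('n)"
  shows "\<exists>a. a \<noteq> 0 \<and> H = linear_zeros a"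
proof -
  obtain B where B: "B \<subseteq> H" "vec.independent B" "H \<subseteq> vec.span B" "card B = vec.dim H"
    using vec.basis_exists by blast
  have spB: "vec.span B = H" using B vec.span_minimal[OF B(1) H(1)] by blast
  have "H \<noteq> UNIV" using H(2) vec_dim_card[where 'a='k and 'n='n] by auto
  then obtain v where v: "v \<notin> vec.span B" using spB by blast
  define B' where "B' = insert v B"
  have iB': "vec.independent B'" unfolding B'_def using v B(2) by (rule vec.independent_insertI)
  have "v \<notin> B" using v vec.span_base by blast
  moreover have "finite B" using B(2) by (rule vec.finiteI_independent)
  ultimately have "card B' = vec.dim (UNIV :: ('k ^ 'n) set)"
    using B(4) H(2) vec_dim_card[where 'a='k and 'n='n] by (simp add: B'_def)
  then have spB': "vec.span B' = UNIV"
    using vec.card_ge_dim_independent[of B' UNIV] iB' by auto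
  define f where "f = (\<lambda>x. vec.representation B' x v)"
  have fadd: "f (x + y) = f x + f y" for x y
    unfolding f_def using vec.representation_add[OF iB'] spB' by simp
  have fscale: "f (c *s x) = c * f x" for c x
    unfolding f_def using vec.representation_scale[OF iB'] spB' by simp
  have fsum: "f (sum g A) = (\<Sum>a\<in>A. f (g a))" for g :: "'n \<Rightarrow> 'k ^ 'n" and A
    by (induction A rule: infinite_finite_induct) (simp_all add: fadd, simp_all add: f_def vec.representation_zero)
  have fv: "f v = 1"
    unfolding f_def using vec.representation_basis[OF iB', of v] by (simp add: B'_def)
  have fH: "f x = 0" if "x \<in> H" for x
  proof -
    have "vec.representation B' x = vec.representation B x"
      using that spB by (intro vec.representation_extend[OF iB']) (auto simp: B'_def)
    then show ?thesis using vec.representation_ne_zero[of B x v] \<open>v \<notin> B\<close> unfolding f_def by auto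
  qed
  define a where "a = (\<chi> i. f (axis i 1))"
  have fa: "f x = (\<Sum>i\<in>UNIV. a $ i * x $ i)" for x
  proof -
    have "f x = f (\<Sum>i\<in>UNIV. x $ i *s axis i 1)" by (simp add: basis_expansion)
    also have "\<dots> = (\<Sum>i\<in>UNIV. a $ i * x $ i)" by (simp add: fsum fscale a_def mult.commute)
    finally show ?thesis .
  qed
  have "x \<in> H" if "f x = 0" for x
  proof -
    have "x \<in> vec.span (insert v B)" using spB' B'_def by auto
    then obtain k where k: "x - k *s v \<in> H" unfolding vec.span_breakdown_eq spB by blast
    have "f x = f (x - k *s v) + k * f v" using fadd[of "x - k *s v" "k *s v"] fscale by simp
    then have "k = 0" using fH[OF k] fv that by simp
    then show ?thesis using k by simp
  qed
  then have "H = linear_zeros a" using fH unfolding linear_zeros_def fa[symmetric] by blast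
  moreover have "a \<noteq> 0" using fv unfolding fa by auto
  ultimately show ?thesis by blast
qed

lemma proj_hyperplane_iff: "proj_hyperplane D \<longleftrightarrow> (\<exists>a. a \<noteq> 0 \<and> D = hyperplane_points a)"
proof
  assume "proj_hyperplane D"
  then show "\<exists>a. a \<noteq> 0 \<and> D = hyperplane_points a"
    unfolding proj_hyperplane_def hyperplane_points_def by (auto dest!: subspace_eq_linear_zeros)
next
  assume "\<exists>a. a \<noteq> 0 \<and> D = hyperplane_points a"
  then obtain a where "a \<noteq> 0" "D = hyperplane_points a" by blast
  then show "proj_hyperplane D"
    unfolding proj_hyperplane_def hyperplane_points_def
    by (intro exI[of _ "linear_zeros a"]) (simp add: subspace_linear_zeros dim_linear_zeros[simplified])
qed

lemma hom_coords_eq: "hom_coords x = range (\<lambda>c. c *s x)"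
  by (simp add: hom_coords_def vec.span_singleton)

lemma self_in_hom_coords: "x \<in> hom_coords x"
  by (simp add: hom_coords_def vec.span_base)

lemma hom_coords_in_proj_space: "x \<noteq> 0 \<Longrightarrow> hom_coords x \<in> proj_space"
  unfolding proj_space_def hom_coords_def
  by (simp add: vec.dim_eq_card_independent vec.independent_insertI)

lemma hom_coords_in_hyperplane_points:
  "x \<noteq> 0 \<Longrightarrow> hom_coords x \<in> hyperplane_points a \<longleftrightarrow> x \<in> linear_zeros a"
  unfolding hyperplane_points_def
  using self_in_hom_coords[of x] vec.subspace_scale[OF subspace_linear_zeros, of x a]
  by (auto simp: hom_coords_in_proj_space) (auto simp: hom_coords_eq)

lemma linear_zeros_axis: "linear_zeros (axis i 1) = {x. x $ i = 0}"
  by (simp add: linear_zeros_def axis_def if_distrib[of "\<lambda>z. z * _"] cong: if_cong)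

section \<open>Points of the orbit and of its closure\<close>

definition torus_point :: "nat \<Rightarrow> ('n \<Rightarrow> nat \<Rightarrow> int) \<Rightarrow> (nat \<Rightarrow> 'k::field) \<Rightarrow> 'k ^ 'n" where
  "torus_point r w t = (\<chi> i. torus_character r (w i) t)"

lemma torus_point_nonzero: "t \<in> torus r \<Longrightarrow> torus_point r w t \<noteq> 0"
  by (auto simp: torus_point_def vec_eq_iff torus_character_nonzero)

lemma torus_act_hom_coords_one:
  "torus_act r w t (hom_coords (\<chi> i. 1)) = hom_coords (torus_point r w t)"
  unfolding torus_act_def hom_coords_eq torus_point_def
  by (auto simp: image_iff vec_eq_iff mult.commute)

lemma orbit_closure_subset:
  fixes w :: "'n::finite \<Rightarrow> nat \<Rightarrow> int" and F :: "('n, 'k::field) mpolynomial set"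
  assumes "\<And>f. f \<in> F \<Longrightarrow> homogeneous f"
    and "\<And>f c t. f \<in> F \<Longrightarrow> t \<in> torus r \<Longrightarrow> mpoly_eval f (c *s torus_point r w t) = 0"
  shows "orbit_closure r w \<subseteq> proj_zeros F"
  unfolding orbit_closure_def zariski_closure_def
proof (rule hull_minimal)
  show "(\<lambda>t. torus_act r w t (hom_coords (\<chi> i. 1))) ` torus r \<subseteq> proj_zeros F"
  proof (rule image_subsetI, unfold torus_act_hom_coords_one)
    fix t :: "nat \<Rightarrow> 'k" assume "t \<in> torus r"
    then show "hom_coords (torus_point r w t) \<in> proj_zeros F"
      using assms(2) hom_coords_in_proj_space[OF torus_point_nonzero]
      by (auto simp: proj_zeros_def hom_coords_eq)
  qed
  show "zariski_closed (proj_zeros F)" unfolding zariski_closed_def using assms(1) by blast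
qed

lemma orbit_subset_closure: "t \<in> torus r \<Longrightarrow> hom_coords (torus_point r w t) \<in> orbit_closure r w"
  unfolding orbit_closure_def zariski_closure_def
  using hull_subset[of "(\<lambda>t. torus_act r w t (hom_coords (\<chi> i. 1))) ` torus r" zariski_closed]
  by (auto simp: torus_act_hom_coords_one)

lemma prod_powi: "x \<noteq> 0 \<Longrightarrow> (\<Prod>q\<in>A. x powi g q) = (x::'k::field) powi (\<Sum>q\<in>A. g q)"
  by (induction A rule: infinite_finite_induct) (simp_all add: power_int_add)

text \<open>The cocharacters \<open>u\<close> and \<open>v\<close> carry the pair of
  \<open>x\<close> and \<open>y\<close> into the torus, where the character \<open>w k\<close>
  becomes a Laurent monomial whose exponents are its pairings with \<open>u\<close> and
  \<open>v\<close>.\<close>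

lemma one_parameter_torus_point:
  fixes x y :: "'k::field" and u v :: "nat \<Rightarrow> int"
  assumes "x \<noteq> 0" "y \<noteq> 0"
  shows "\<exists>t\<in>torus r. \<forall>k. torus_point r w t $ k = x powi (\<Sum>q<r. u q * w k q) * y powi (\<Sum>q<r. v q * w k q)"
proof -
  define c where "c = (\<lambda>z (l :: nat \<Rightarrow> int) q. if q < r then z powi l q else (1::'k))"
  have c: "c z l \<in> torus r" "torus_character r m (c z l) = z powi (\<Sum>q<r. l q * m q)"
    if "z \<noteq> 0" for z l m
    using that by (auto simp: c_def torus_def torus_character_def prod_powi simp flip: power_int_mult)
  show ?thesis
    using c assms by (intro bexI[of _ "\<lambda>j. c x u j * c y v j"])
      (simp_all add: torus_point_def torus_character_mult mult_in_torus)
qed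

text \<open>The curve \<open>s \<mapsto> (s\<^bsup>e k\<^esup>)\<^sub>k\<close> lies in the orbit for \<open>s \<noteq> 0\<close> and
  tends to the coordinate point \<open>i\<close> as \<open>s\<close> tends to 0.\<close>

lemma axis_in_orbit_closure:
  fixes w :: "'n::finite \<Rightarrow> nat \<Rightarrow> int" and l :: "nat \<Rightarrow> int"
  assumes "\<And>k. k \<noteq> i \<Longrightarrow> (\<Sum>q<r. l q * w k q) < (\<Sum>q<r. l q * w i q)"
  shows "hom_coords (axis i (1::'k::alg_closed_field)) \<in> orbit_closure r w"
  unfolding orbit_closure_def zariski_closure_def hull_def
proof (rule InterI)
  fix Z :: "('k ^ 'n) set set"
  assume "Z \<in> {Z. zariski_closed Z \<and> (\<lambda>t. torus_act r w t (hom_coords (\<chi> i. 1))) ` torus r \<subseteq> Z}"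
  then obtain F where Z: "Z = proj_zeros F"
    and orb: "\<And>t. t \<in> torus r \<Longrightarrow> hom_coords (torus_point r w t) \<in> Z"
    unfolding zariski_closed_def by (auto simp: torus_act_hom_coords_one)
  define h where "h = (\<lambda>k. \<Sum>q<r. l q * w k q)"
  \<comment> \<open>Scaling by \<open>s powi h i\<close> turns the exponents into natural numbers,
    with \<open>e i = 0\<close> and all others positive.\<close>
  define e where "e = (\<lambda>k. nat (h i - h k))"
  have le: "h k \<le> h i" for k using assms[of k] by (cases "k = i") (auto simp: h_def)
  have "mpoly_eval f (c *s axis i 1) = 0" if f: "f \<in> F" for f c
  proof -
    \<comment> \<open>\<open>p\<close> is \<open>f\<close> along the curve, as a polynomial in
      \<open>s\<close>. It vanishes off 0 and therefore at 0, where the convention that 0 to the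
      power 0 is 1 leaves the coordinate vector \<open>axis i 1\<close>.\<close>
    define p where "p = (\<Sum>m\<in>Poly_Mapping.keys f. monom (Poly_Mapping.lookup f m *
      (\<Prod>k\<in>UNIV. c ^ Poly_Mapping.lookup m k)) (\<Sum>k\<in>UNIV. e k * Poly_Mapping.lookup m k))"
    have p: "poly p s = mpoly_eval f (c *s (\<chi> k. s ^ e k))" for s
      unfolding p_def mpoly_eval_def
      by (simp add: poly_sum poly_monom power_mult_distrib prod.distrib power_sum power_mult mult.assoc)
    have "poly p s = 0" if s: "s \<noteq> 0" for s
    proof -
      obtain t where t: "t \<in> torus r" "\<And>k. torus_point r w t $ k = s powi (- h k)"
        using one_parameter_torus_point[of s 1 r w "\<lambda>q. - l q" "\<lambda>_. 0"] s
        by (auto simp: h_def sum_negf)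
      have "s ^ e k = s powi (h i - h k)" for k using le[of k] by (simp add: e_def power_int_def)
      then have "(\<chi> k. s ^ e k) = (s powi h i) *s torus_point r w t"
        using s by (simp add: vec_eq_iff t power_int_diff power_int_minus field_simps)
      then have "c *s (\<chi> k. s ^ e k) \<in> hom_coords (torus_point r w t)"
        unfolding hom_coords_eq by (auto simp: vector_smult_assoc)
      then show ?thesis using orb[OF t(1)] f unfolding p Z proj_zeros_def by blast
    qed
    then have "p = 0" by (rule poly_zero_if_zero_off_origin)
    moreover have "(\<chi> k. (0::'k) ^ e k) = axis i 1"
      using assms by (auto simp: vec_eq_iff axis_def e_def h_def zero_power)
    ultimately show ?thesis using p[of 0] by simp
  qed
  moreover have "hom_coords (axis i (1::'k)) \<in> proj_space"
    by (rule hom_coords_in_proj_space) (simp add: axis_eq_0_iff)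
  ultimately show "hom_coords (axis i 1) \<in> Z"
    unfolding Z proj_zeros_def by (auto simp: hom_coords_eq)
qed

section \<open>Binomial equations of the orbit\<close>

definition exponent :: "('n::finite \<Rightarrow> nat) \<Rightarrow> 'n \<Rightarrow>\<^sub>0 nat" where
  "exponent g = Poly_Mapping.Abs_poly_mapping g"

lemma lookup_exponent [simp]: "Poly_Mapping.lookup (exponent g) = g"
  by (simp add: exponent_def)

definition pure_binomial :: "('n::finite \<Rightarrow> nat) \<Rightarrow> ('n \<Rightarrow> nat) \<Rightarrow> ('n, 'k::field) mpolynomial" where
  "pure_binomial g h = Poly_Mapping.single (exponent g) 1 - Poly_Mapping.single (exponent h) 1"

lemma keys_pure_binomial: "Poly_Mapping.keys (pure_binomial g h) \<subseteq> {exponent g, exponent h}"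
  unfolding pure_binomial_def by (rule order_trans[OF keys_diff]) auto

lemma mpoly_eval_pure_binomial:
  "mpoly_eval (pure_binomial g h) x = (\<Prod>i\<in>UNIV. x $ i ^ g i) - (\<Prod>i\<in>UNIV. x $ i ^ h i)"
proof (cases "exponent g = exponent h")
  case True
  then have "g = h" by (metis lookup_exponent)
  then show ?thesis by (simp add: mpoly_eval_def pure_binomial_def)
next
  case False
  have "mpoly_eval (pure_binomial g h) x = (\<Sum>e\<in>{exponent g, exponent h}.
      Poly_Mapping.lookup (pure_binomial g h) e * (\<Prod>i\<in>UNIV. x $ i ^ Poly_Mapping.lookup e i))"
    unfolding mpoly_eval_def
    by (rule sum.mono_neutral_left) (use keys_pure_binomial in \<open>auto simp: in_keys_iff\<close>)
  then show ?thesis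
    using False by (simp add: pure_binomial_def lookup_minus lookup_single)
qed

lemma homogeneous_pure_binomial:
  "sum g UNIV = sum h UNIV \<Longrightarrow> homogeneous (pure_binomial g h)"
  unfolding homogeneous_def using keys_pure_binomial[of g h] by (intro exI[of _ "sum g UNIV"]) auto

lemma torus_character_power: "torus_character r m t ^ n = torus_character r (\<lambda>j. int n * m j) t"
  by (simp add: torus_character_def prod_power_distrib power_int_mult mult.commute[of "int n"])

lemma torus_character_sum:
  "finite A \<Longrightarrow> t \<in> torus r \<Longrightarrow>
    torus_character r (\<lambda>j. \<Sum>k\<in>A. f k j) t = (\<Prod>k\<in>A. torus_character r (f k) t)"
proof (induction A rule: finite_induct)
  case empty
  then show ?case by (simp add: torus_character_def)
next
  case (insert a A)
  then show ?case using torus_character_add[of t r "f a" "\<lambda>j. \<Sum>k\<in>A. f k j"] by simp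
qed

section \<open>The separation property\<close>

text \<open>Multiplying the weights by a common denominator \<open>D\<close> makes them natural
  numbers, with sum \<open>D\<close> because the weights sum to 1.\<close>

lemma convex_dependent_integral:
  fixes w :: "'n::finite \<Rightarrow> nat \<Rightarrow> int"
  assumes "convex_dependent (\<lambda>k. rat_point (w k))"
  shows "\<exists>i n. n i = 0 \<and> 0 < sum n UNIV \<and>
    (\<forall>j. int (sum n UNIV) * w i j = (\<Sum>k\<in>UNIV. int (n k) * w k j))"
proof -
  obtain i c where c: "\<And>k. 0 \<le> c k" "c i = 0" "sum c UNIV = 1"
    "rat_point (w i) = (\<lambda>j. \<Sum>k\<in>UNIV. c k * rat_point (w k) j)"
    using assms unfolding convex_dependent_def by blast
  obtain D where D: "D > 0" "\<forall>k\<in>UNIV. \<exists>z. of_int z = of_int D * c k"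
    using clear_denominators[of UNIV c] by auto
  from bchoice[OF D(2)] obtain z where z: "\<And>k. of_int (z k) = of_int D * c k" by auto
  have zpos: "0 \<le> z k" for k
  proof -
    have "(0::rat) \<le> of_int (z k)" using c(1) D(1) by (simp add: z)
    then show ?thesis by simp
  qed
  define n where "n = (\<lambda>k. nat (z k))"
  have n: "of_nat (n k) = of_int D * c k" for k
    using z[of k] zpos[of k] by (simp add: n_def)
  have "rat_of_nat (sum n UNIV) = of_int D" by (simp add: n c(3) flip: sum_distrib_left)
  moreover have "rat_of_int (w i j) = (\<Sum>k\<in>UNIV. c k * of_int (w k j))" for j
    using fun_cong[OF c(4), of j] by (simp add: rat_point_def)
  ultimately have "rat_of_int (int (sum n UNIV) * w i j) = of_int (\<Sum>k\<in>UNIV. int (n k) * w k j)" for j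
    by (simp add: n sum_distrib_left mult.assoc)
  then have "int (sum n UNIV) * w i j = (\<Sum>k\<in>UNIV. int (n k) * w k j)" for j by (simp only: of_int_eq_iff)
  moreover have "n i = 0" using n[of i] c(2) by simp
  moreover have "0 < sum n UNIV"
  proof -
    have "rat_of_nat (sum n UNIV) > 0" using \<open>rat_of_nat (sum n UNIV) = of_int D\<close> D(1) by simp
    then show ?thesis by (simp only: of_nat_0_less_iff)
  qed
  ultimately show ?thesis by blast
qed

lemma not_separation_if_convex_dependent:
  fixes w :: "'n::finite \<Rightarrow> nat \<Rightarrow> int"
  assumes "convex_dependent (\<lambda>k. rat_point (w k))"
  shows "\<not> separation_property (orbit_closure r w :: ('k::alg_closed_field ^ 'n) set set)"
proof -
  obtain i n where n: "n i = 0" "0 < sum n UNIV"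
    "\<And>j. int (sum n UNIV) * w i j = (\<Sum>k\<in>UNIV. int (n k) * w k j)"
    using convex_dependent_integral[OF assms] by blast
  define d where "d = sum n UNIV"
  obtain m where m: "n m \<noteq> 0" using n(2) by (metis less_irrefl sum.neutral)
  then have mi: "m \<noteq> i" using n(1) by auto
  define g where "g = (\<lambda>k. if k = i then d else 0)"
  define f :: "('n, 'k) mpolynomial" where "f = pure_binomial g n"
  have eval: "mpoly_eval f x = x $ i ^ d - (\<Prod>k\<in>UNIV. x $ k ^ n k)" for x
  proof -
    have "(\<Prod>k\<in>UNIV. x $ k ^ g k) = (\<Prod>k\<in>UNIV. if k = i then x $ i ^ d else 1)"
      by (rule prod.cong) (auto simp: g_def)
    then show ?thesis by (simp add: f_def mpoly_eval_pure_binomial)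
  qed
  have X: "(orbit_closure r w :: ('k ^ 'n) set set) \<subseteq> proj_zeros {f}"
  proof (rule orbit_closure_subset; simp)
    show "homogeneous f" unfolding f_def by (rule homogeneous_pure_binomial) (simp add: g_def d_def)
    fix c :: 'k and t :: "nat \<Rightarrow> 'k" assume t: "t \<in> torus r"
    have "torus_character r (w i) t ^ d = (\<Prod>k\<in>UNIV. torus_character r (w k) t ^ n k)"
      by (simp only: torus_character_power d_def n(3) torus_character_sum[OF finite t])
    then show "mpoly_eval f (c *s torus_point r w t) = 0"
      by (simp add: eval torus_point_def power_mult_distrib prod.distrib d_def power_sum)
  qed
  let ?D = "\<lambda>k. hyperplane_points (axis k (1::'k))"
  have "?D m \<inter> orbit_closure r w \<subseteq> ?D i"
  proof
    fix L assume L: "L \<in> ?D m \<inter> orbit_closure r w"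
    have "x $ i = 0" if x: "x \<in> L" for x
    proof -
      have "x $ m = 0" using L x by (auto simp: hyperplane_points_def linear_zeros_axis)
      then have "(\<Prod>k\<in>UNIV. x $ k ^ n k) = 0" using m by (intro prod_zero) auto
      moreover have "mpoly_eval f x = 0" using L x X by (auto simp: proj_zeros_def)
      ultimately have "x $ i ^ d = 0" by (simp only: eval diff_zero)
      then show ?thesis by simp
    qed
    then show "L \<in> ?D i" using L by (auto simp: hyperplane_points_def linear_zeros_axis)
  qed
  moreover have "?D m \<noteq> ?D i"
  proof -
    have "hom_coords (axis i (1::'k)) \<in> ?D m" "hom_coords (axis i (1::'k)) \<notin> ?D i"
      using mi by (simp_all add: hom_coords_in_hyperplane_points linear_zeros_axis axis_eq_0_iff)
        (simp_all add: axis_def)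
    then show ?thesis by blast
  qed
  moreover have "proj_hyperplane (?D k)" for k
    unfolding proj_hyperplane_iff by (intro exI[of _ "axis k 1"]) (simp add: axis_eq_0_iff)
  ultimately show ?thesis unfolding separation_property_def by blast
qed

text \<open>Cocharacters have integral entries. Only the order of the values matters, and a positive
  common denominator preserves it.\<close>

lemma integral_functional:
  fixes w :: "'n::finite \<Rightarrow> nat \<Rightarrow> int"
  shows "\<exists>L. \<forall>k k'. (\<Sum>q<r. L q * w k q) < (\<Sum>q<r. L q * w k' q) \<longleftrightarrow>
    pairing r l (rat_point (w k)) < pairing r l (rat_point (w k'))"
proof -
  obtain D where D: "D > 0" "\<forall>q\<in>{..<r}. \<exists>z. of_int z = of_int D * l q"
    using clear_denominators[of "{..<r}" l] by auto
  from bchoice[OF D(2)] obtain L where L: "\<And>q. q < r \<Longrightarrow> of_int (L q) = of_int D * l q" by auto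
  have val: "rat_of_int (\<Sum>q<r. L q * w k q) = of_int D * pairing r l (rat_point (w k))" for k
    by (simp add: L pairing_def rat_point_def sum_distrib_left mult.assoc)
  have "(\<Sum>q<r. L q * w k q) < (\<Sum>q<r. L q * w k' q) \<longleftrightarrow>
    rat_of_int (\<Sum>q<r. L q * w k q) < rat_of_int (\<Sum>q<r. L q * w k' q)" for k k'
    by (simp only: of_int_less_iff)
  then show ?thesis using D(1) unfolding val by (intro exI[of _ L]) simp
qed

text \<open>The two functionals give a two-parameter subgroup: \<open>l\<close> makes
  \<open>i\<close> the leading term in the first parameter, and \<open>f\<close> leaves only
  \<open>i\<close> and \<open>j\<close> from the support of \<open>a\<close> when the second one
  tends to 0.\<close>

lemma ratio_eq_on_edge:
  fixes w :: "'n::finite \<Rightarrow> nat \<Rightarrow> int" and a b :: "'k::alg_closed_field ^ 'n"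
  assumes "i \<noteq> j" "a $ i \<noteq> 0" "a $ j \<noteq> 0" and supp: "\<And>k. a $ k = 0 \<Longrightarrow> b $ k = 0"
    and l: "\<And>k. k \<noteq> i \<Longrightarrow> pairing r l (rat_point (w k)) < pairing r l (rat_point (w i))"
    and f: "pairing r f (rat_point (w j)) = pairing r f (rat_point (w i))"
      "\<And>k. a $ k \<noteq> 0 \<Longrightarrow> k \<noteq> i \<Longrightarrow> k \<noteq> j \<Longrightarrow> pairing r f (rat_point (w k)) < pairing r f (rat_point (w i))"
    and sub: "\<And>t. t \<in> torus r \<Longrightarrow> torus_point r w t \<in> linear_zeros a \<Longrightarrow> torus_point r w t \<in> linear_zeros b"
  shows "b $ i * a $ j = b $ j * a $ i"
proof -
  obtain L where L: "\<And>k k'. (\<Sum>q<r. L q * w k q) < (\<Sum>q<r. L q * w k' q) \<longleftrightarrow>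
    pairing r l (rat_point (w k)) < pairing r l (rat_point (w k'))"
    using integral_functional[of w r l] by blast
  obtain F where F: "\<And>k k'. (\<Sum>q<r. F q * w k q) < (\<Sum>q<r. F q * w k' q) \<longleftrightarrow>
    pairing r f (rat_point (w k)) < pairing r f (rat_point (w k'))"
    using integral_functional[of w r f] by blast
  define x where "x = (\<lambda>k. \<Sum>q<r. L q * w k q)"
  define y where "y = (\<lambda>k. \<Sum>q<r. F q * w k q)"
  \<comment> \<open>Subtracting the minimum makes all exponents of the first parameter natural
    numbers.\<close>
  define A where "A = Min (range x)"
  have A: "A \<le> x k" for k by (simp add: A_def)
  have x: "x k < x i" if "k \<noteq> i" for k using l[OF that] L by (simp add: x_def)
  have yj: "y j = y i" using f(1) F[of i j] F[of j i] unfolding y_def by linarith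
  have yk: "y k < y i" if "a $ k \<noteq> 0" "k \<noteq> i" "k \<noteq> j" for k using f(2)[OF that] F by (simp add: y_def)
  have y: "y k \<le> y i" if "a $ k \<noteq> 0" for k
    using yk[OF that] yj by (cases "k = i"; cases "k = j") auto
  show ?thesis
  proof (rule ratio_eq_of_degeneration[where e = "\<lambda>k. nat (x k - A)" and f = "\<lambda>k. nat (y i - y k)"])
    show "nat (x k - A) < nat (x i - A)" if "a $ k \<noteq> 0" "k \<noteq> i" for k
      using x[OF that(2)] A[of k] by simp
    show "0 < nat (y i - y k)" if "a $ k \<noteq> 0" "k \<noteq> i" "k \<noteq> j" for k using yk[OF that] by simp
    fix u v :: 'k
    assume uv: "u \<noteq> 0" "v \<noteq> 0"
      and zero: "(\<Sum>k\<in>UNIV. a $ k * (u ^ nat (x k - A) * v ^ nat (y i - y k))) = 0"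
    obtain t where t: "t \<in> torus r" "\<And>k. torus_point r w t $ k = u powi x k * v powi (- y k)"
      using one_parameter_torus_point[OF uv, of r w L "\<lambda>q. - F q"]
      by (auto simp: x_def y_def sum_negf)
    define c where "c = u powi (- A) * v powi y i"
    have c: "c \<noteq> 0" using uv by (simp add: c_def)
    \<comment> \<open>\<open>c\<close> compensates for the shifts of the exponents. Outside the
      support of \<open>a\<close>, \<open>nat\<close> may truncate a negative exponent, but there
      both coefficients are zero.\<close>
    have scaled: "d $ k * (u ^ nat (x k - A) * v ^ nat (y i - y k)) = c * (d $ k * torus_point r w t $ k)"
      if "d = a \<or> d = b" for d k
    proof (cases "a $ k = 0")
      case True
      then show ?thesis using that supp by auto
    next
      case False
      have "u ^ nat (x k - A) = u powi (x k - A)" "v ^ nat (y i - y k) = v powi (y i - y k)"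
        using A[of k] y[OF False] by (simp_all add: power_int_def)
      then show ?thesis using uv by (simp add: c_def t power_int_diff power_int_minus field_simps)
    qed
    have "c * (\<Sum>k\<in>UNIV. a $ k * torus_point r w t $ k) = 0"
      using zero by (simp add: scaled sum_distrib_left)
    then have "torus_point r w t \<in> linear_zeros a" using c by (simp add: linear_zeros_def)
    from sub[OF t(1) this] have "c * (\<Sum>k\<in>UNIV. b $ k * torus_point r w t $ k) = 0"
      by (simp add: linear_zeros_def)
    then show "(\<Sum>k\<in>UNIV. b $ k * (u ^ nat (x k - A) * v ^ nat (y i - y k))) = 0"
      by (simp add: scaled sum_distrib_left)
  qed (use assms(1-4) yj in auto)
qed

lemma separation_if_exposed:
  fixes w :: "'n::finite \<Rightarrow> nat \<Rightarrow> int"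
  assumes exposed: "\<And>i. \<exists>l. \<forall>k. k \<noteq> i \<longrightarrow>
    pairing r l (rat_point (w k)) < pairing r l (rat_point (w i))"
  shows "separation_property (orbit_closure r w :: ('k::alg_closed_field ^ 'n) set set)"
  unfolding separation_property_def
proof (intro allI impI notI, elim conjE)
  fix D D' :: "('k ^ 'n) set set"
  assume "proj_hyperplane D" "proj_hyperplane D'" and ne: "D \<noteq> D'"
    and DD': "D \<inter> orbit_closure r w \<subseteq> D'"
  then obtain a b where a: "a \<noteq> 0" "D = hyperplane_points a" and b: "b \<noteq> 0" "D' = hyperplane_points b"
    unfolding proj_hyperplane_iff by blast
  have supp: "b $ k = 0" if "a $ k = 0" for k
  proof -
    obtain l where "\<forall>m. m \<noteq> k \<longrightarrow> pairing r l (rat_point (w m)) < pairing r l (rat_point (w k))"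
      using exposed by blast
    then obtain L where "\<And>m. m \<noteq> k \<Longrightarrow> (\<Sum>q<r. L q * w m q) < (\<Sum>q<r. L q * w k q)"
      using integral_functional[of w r l] by blast
    then have X: "hom_coords (axis k (1::'k)) \<in> orbit_closure r w" by (rule axis_in_orbit_closure)
    have lz: "axis k 1 \<in> linear_zeros d \<longleftrightarrow> d $ k = 0" for d :: "'k ^ 'n"
      by (simp add: linear_zeros_def axis_def if_distrib[of "\<lambda>z. _ * z"] cong: if_cong)
    have nz: "axis k (1::'k) \<noteq> 0" by (simp add: axis_eq_0_iff)
    have "hom_coords (axis k (1::'k)) \<in> D'"
      using DD' X that unfolding a(2) by (auto simp: hom_coords_in_hyperplane_points[OF nz] lz)
    then show ?thesis unfolding b(2) by (simp add: hom_coords_in_hyperplane_points[OF nz] lz)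
  qed
  have sub: "torus_point r w t \<in> linear_zeros b"
    if "t \<in> torus r" "torus_point r w t \<in> linear_zeros a" for t
  proof -
    have nz: "torus_point r w t \<noteq> 0" using that(1) by (rule torus_point_nonzero)
    have "hom_coords (torus_point r w t) \<in> D"
      using that(2) unfolding a(2) hom_coords_in_hyperplane_points[OF nz] .
    then have "hom_coords (torus_point r w t) \<in> D'"
      using DD' orbit_subset_closure[OF that(1)] by blast
    then show ?thesis unfolding b(2) hom_coords_in_hyperplane_points[OF nz] .
  qed
  define I where "I = {k. a $ k \<noteq> 0}"
  obtain m where m: "m \<in> I" using a(1) by (auto simp: I_def vec_eq_iff)
  obtain c where c: "\<And>k. k \<noteq> m \<Longrightarrow> pairing r c (rat_point (w k)) < pairing r c (rat_point (w m))"
    using exposed[of m] by blast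
  \<comment> \<open>These are the indices in the support of \<open>a\<close> at which the ratio of
    \<open>b\<close> to \<open>a\<close> differs from the ratio at \<open>m\<close>.\<close>
  define N where "N = {k\<in>I. b $ k * a $ m \<noteq> b $ m * a $ k}"
  have "N = {}"
  proof (rule ccontr)
    assume "N \<noteq> {}"
    define g where "g = (\<lambda>k. pairing r c (rat_point (w k)))"
    have "Max (g ` N) \<in> g ` N" using \<open>N \<noteq> {}\<close> by (intro Max_in) auto
    \<comment> \<open>\<open>i\<close> is the best index of \<open>N\<close> with respect to
      \<open>c\<close>. As \<open>m\<close> is better still, an improving edge leads to some
      \<open>j\<close>, which lies outside \<open>N\<close> by maximality; but the ratio is constant
      along the edge, so \<open>i\<close> would share the ratio at \<open>m\<close>.\<close>
    then obtain i where i: "i \<in> N" "g i = Max (g ` N)" by auto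
    have max: "pairing r c (rat_point (w k)) \<le> pairing r c (rat_point (w i))" if "k \<in> N" for k
      using Max_ge[of "g ` N" "g k"] that i(2) by (simp add: g_def)
    have im: "i \<noteq> m" using i by (auto simp: N_def)
    have exposed_I: "\<exists>l. \<forall>k\<in>I - {j}. pairing r l (rat_point (w k)) < pairing r l (rat_point (w j))" for j
      using exposed[of j] by auto
    have iI: "i \<in> I" using i(1) by (simp add: N_def)
    have "\<exists>j\<in>I. pairing r c (rat_point (w i)) < pairing r c (rat_point (w j)) \<and>
      (\<exists>f. pairing r f (rat_point (w j)) = pairing r f (rat_point (w i)) \<and>
        (\<forall>k\<in>I - {i, j}. pairing r f (rat_point (w k)) < pairing r f (rat_point (w i))))"
      by (rule improving_edge[of I i m r c "\<lambda>k. rat_point (w k)"]) (use iI m c[OF im] exposed_I in auto)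
    then obtain j f where j: "j \<in> I" "pairing r c (rat_point (w i)) < pairing r c (rat_point (w j))"
      and f: "pairing r f (rat_point (w j)) = pairing r f (rat_point (w i))"
        "\<And>k. k \<in> I - {i, j} \<Longrightarrow> pairing r f (rat_point (w k)) < pairing r f (rat_point (w i))" by blast
    obtain l where l: "\<And>k. k \<noteq> i \<Longrightarrow> pairing r l (rat_point (w k)) < pairing r l (rat_point (w i))"
      using exposed[of i] by blast
    have "b $ i * a $ j = b $ j * a $ i"
      by (rule ratio_eq_on_edge[OF _ _ _ supp l f(1) _ sub]) (use i j f in \<open>auto simp: I_def N_def\<close>)
    moreover have "b $ j * a $ m = b $ m * a $ j" using max[of j] j by (auto simp: N_def)
    ultimately have "(b $ i * a $ m) * a $ j = (b $ m * a $ i) * a $ j" by (metis mult.assoc mult.commute)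
    then show False using i j(1) by (simp add: N_def I_def)
  qed
  define s where "s = b $ m / a $ m"
  have am: "a $ m \<noteq> 0" using m by (simp add: I_def)
  have bs: "b $ k = s * a $ k" for k
    using \<open>N = {}\<close> supp[of k] am by (cases "a $ k = 0") (auto simp: s_def N_def I_def field_simps)
  then have "s \<noteq> 0" using b(1) by (auto simp: vec_eq_iff)
  then have "linear_zeros b = linear_zeros a"
    by (simp add: linear_zeros_def bs mult.assoc flip: sum_distrib_left)
  then show False using ne unfolding a(2) b(2) hyperplane_points_def by simp
qed

theorem theorem3:
  fixes r :: nat and w :: "'n::finite \<Rightarrow> nat \<Rightarrow> int"
  assumes "\<And>i. w i \<in> character_lattice r"
  shows "separation_property (orbit_closure r w :: ('k::alg_closed_field ^ 'n) set set) \<longleftrightarrow>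
    (\<forall>i. vertex_of (rat_point (w i)) (rat_convex hull range (\<lambda>j. rat_point (w j)))) \<and>
    (\<forall>i j. i \<noteq> j \<longrightarrow> w i \<noteq> w j)"
proof -
  let ?p = "\<lambda>k. rat_point (w k)"
  have inj: "inj ?p \<longleftrightarrow> (\<forall>i j. i \<noteq> j \<longrightarrow> w i \<noteq> w j)"
    by (auto simp: inj_def rat_point_def fun_eq_iff)
  have "\<exists>l. \<forall>k. k \<noteq> i \<longrightarrow> pairing r l (?p k) < pairing r l (?p i)"
    if "\<not> convex_dependent ?p" for i
    using that assms
    by (intro exposed_of_not_convex_dependent) (auto simp: rat_point_def character_lattice_def)
  \<comment> \<open>The implications close up: independence gives exposing functionals, these give
    separation, and separation excludes a dependence.\<close>
  then have "\<not> convex_dependent ?p \<longleftrightarrow>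
      separation_property (orbit_closure r w :: ('k ^ 'n) set set)"
    using not_separation_if_convex_dependent[of w r, where 'k = 'k]
      separation_if_exposed[of r w, where 'k = 'k] by metis
  then show ?thesis using vertices_distinct_iff[of ?p] unfolding inj by metis
qed

end
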